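(* Let $s\in\mathbb{C}$ with $\mathrm{Re}\,s\in(0,1)$, let $\beta(s)=\sum_{n=0}^\infty(-1)^n(2n+1)^{-s}$ be the Dirichlet beta function, and for $y\in\mathbb{R}$ let $$f_{1,s,1/2}(y)=\frac{\pi2^{s-2}|y|^s}{\sin(\pi s/2)},\qquad g_{1,s,1/2}(y)=-\frac{\pi2^{s-1}y^2\cos y}{\sin(\pi s/2)}\sum_{n=0}^\infty\frac{(-1)^n[\pi(n+1/2)]^{s-1}}{y^2-[\pi(n+1/2)]^2}.$$ Then: (a) If $\beta(s)=0$, then $f_{1,s,1/2}-g_{1,s,1/2}\in L_p(\mathbb{R})$ for every $p\in(1/2,\infty)$. (b) If there exists $p\in(1/2,\infty)$ such that $f_{1,s,1/2}-g_{1,s,1/2}\in L_p(\mathbb{R})$, then $\beta(s)=0$.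
   Context: For $0<p<\infty$, $L_p(\mathbb{R})$ is the space of measurable $F:\mathbb{R}\to\mathbb{C}$ with $\int_{\mathbb{R}}|F(y)|^p\,dy<\infty$ (also for $p<1$). Complex powers of positive reals are principal, and $0^s=0$. At $y=\pm\pi(n+1/2)$ the product $\cos y/(y^2-[\pi(n+1/2)]^2)$ is understood by continuity. The series defining $\beta$ converges (conditionally) for $\mathrm{Re}\,s>0$. *)

theory Defs
  imports "HOL-Analysis.Analysis"
begin

text \<open>The series converges only conditionally for \<open>0 < Re s \<le> 1\<close>; \<^const>\<open>suminf\<close> is the
  limit of the partial sums.\<close>

definition dirichlet_beta :: "complex \<Rightarrow> complex" where
  "dirichlet_beta s = (\<Sum>n. (-1) ^ n * of_nat (2 * n + 1) powr (- s))"

definition Lp_space :: "real \<Rightarrow> (real \<Rightarrow> complex) set" where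
  "Lp_space p =
     {F \<in> borel_measurable lebesgue.
        (\<integral>\<^sup>+ y. ennreal (norm (F y) powr p) \<partial>lebesgue) < \<infinity>}"

definition node :: "nat \<Rightarrow> real" where
  "node n = pi * (real n + 1 / 2)"

text \<open>The function \<open>cos y / (y\<^sup>2 - (node n)\<^sup>2)\<close>, extended by continuity to its removable
  singularities \<open>y = \<plusminus> node n\<close>.\<close>

definition cos_quot :: "nat \<Rightarrow> real \<Rightarrow> real" where
  "cos_quot n y =
     (if y\<^sup>2 = (node n)\<^sup>2 then Lim (at y) (\<lambda>x. cos x / (x\<^sup>2 - (node n)\<^sup>2))
      else cos y / (y\<^sup>2 - (node n)\<^sup>2))"

text \<open>Complex \<^const>\<open>powr\<close> is the principal power on positive reals and satisfies
  \<open>0 powr s = 0\<close>.\<close>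

definition f_half :: "complex \<Rightarrow> real \<Rightarrow> complex" where
  "f_half s y =
     of_real pi * 2 powr (s - 2) * of_real \<bar>y\<bar> powr s / sin (of_real pi * s / 2)"

text \<open>The factor \<open>cos y\<close> stands inside the series, so that the product with
  \<open>1 / (y\<^sup>2 - (node n)\<^sup>2)\<close> can be read by continuity.\<close>

definition g_half :: "complex \<Rightarrow> real \<Rightarrow> complex" where
  "g_half s y =
     - (of_real pi * 2 powr (s - 1) * of_real (y\<^sup>2) / sin (of_real pi * s / 2)) *
       (\<Sum>n. (-1) ^ n * of_real (node n) powr (s - 1) * of_real (cos_quot n y))"

end

theory Submission
  imports Defs
begin

text \<open>The partial fractions of \<open>sec\<close> and \<open>sech\<close> over the nodes, together with
  \<open>\<integral>\<^sub>0\<^sup>\<infinity> t\<^bsup>s-1\<^esup> / (t\<^sup>2 + b\<^sup>2) dt = \<pi> b\<^bsup>s-2\<^esup> / (2 sin (\<pi> s / 2))\<close>, give for almost every \<open>y\<close>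
  \<open>f(y) - g(y) = 2\<^bsup>s-1\<^esup> cos y \<integral>\<^sub>0\<^sup>\<infinity> y\<^sup>2 t\<^bsup>s-1\<^esup> / ((y\<^sup>2 + t\<^sup>2) cosh t) dt\<close>.
  Writing \<open>y\<^sup>2 / (y\<^sup>2 + t\<^sup>2) = 1 - t\<^sup>2 / (y\<^sup>2 + t\<^sup>2)\<close>, the integral is
  \<open>\<integral>\<^sub>0\<^sup>\<infinity> t\<^bsup>s-1\<^esup> / cosh t dt + O(y\<^bsup>-2\<^esup>) = 2 \<Gamma>(s) \<beta>(s) + O(y\<^bsup>-2\<^esup>)\<close>. Hence \<open>f - g\<close> is bounded and
  \<open>O(y\<^bsup>-2\<^esup>)\<close> if \<open>\<beta>(s) = 0\<close>, and comparable to \<open>cos y\<close> at infinity otherwise. No functional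
  equation of \<open>\<beta>\<close> enters.\<close>

section \<open>Partial fractions\<close>

text \<open>For alternating series: partial sums of even length become differences of two digamma
  approximants, and those of odd length differ from them by one vanishing term.\<close>

lemma LIMSEQ_even_odd:
  fixes X :: "nat \<Rightarrow> 'a :: topological_space"
  assumes "(\<lambda>n. X (2 * n)) \<longlonglongrightarrow> L" and "(\<lambda>n. X (2 * n + 1)) \<longlonglongrightarrow> L"
  shows "X \<longlonglongrightarrow> L"
proof (rule topological_tendstoI)
  fix S :: "'a set" assume S: "open S" "L \<in> S"
  have "eventually (\<lambda>n. X (2 * n) \<in> S \<and> X (2 * n + 1) \<in> S) sequentially"
    using topological_tendstoD[OF assms(1) S] topological_tendstoD[OF assms(2) S]
    by (rule eventually_conj)
  then obtain N where N: "\<And>n. n \<ge> N \<Longrightarrow> X (2 * n) \<in> S" "\<And>n. n \<ge> N \<Longrightarrow> X (2 * n + 1) \<in> S"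
    unfolding eventually_sequentially by blast
  have "X n \<in> S" if "n \<ge> 2 * N" for n
    using N(1)[of "n div 2"] N(2)[of "n div 2"] that
    by (cases "even n") (auto simp: even_two_times_div_two odd_two_times_div_two_succ)
  then show "eventually (\<lambda>n. X n \<in> S) sequentially"
    by (auto simp: eventually_sequentially)
qed

lemma sin_pi_times_nonzero:
  fixes z :: complex
  assumes "z \<notin> \<int>"
  shows "sin (of_real pi * z) \<noteq> 0"
proof
  assume "sin (of_real pi * z) = 0"
  then obtain n :: int where "of_real pi * z = of_real (n * pi)"
    unfolding sin_eq_0 by blast
  then have "z = of_int n"
    by simp
  with assms show False
    by simp
qed

text \<open>Logarithmic derivative of Euler's reflection formula in the form
  \<open>rGamma z * rGamma (1 - z) = sin (pi * z) / pi\<close>: both sides are differentiated at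
  \<open>z\<close> and the derivatives compared.\<close>

lemma Digamma_reflection_complex:
  fixes z :: complex
  assumes "z \<notin> \<int>"
  shows "Digamma (1 - z) - Digamma z = of_real pi * cot (of_real pi * z)"
proof -
  have z: "z \<notin> \<int>\<^sub>\<le>\<^sub>0" "1 - z \<notin> \<int>\<^sub>\<le>\<^sub>0"
    using assms Ints_diff[of 1 "1 - z"] by (auto dest: nonpos_Ints_Int)
  have "((\<lambda>z. 1 - z) has_field_derivative -1) (at z)"
    by (auto intro!: derivative_eq_intros)
  from DERIV_mult[OF has_field_derivative_rGamma_no_nonpos_int[OF z(1)]
      DERIV_chain2[OF has_field_derivative_rGamma_no_nonpos_int[OF z(2)] this]]
  have D1: "((\<lambda>z. rGamma z * rGamma (1 - z)) has_field_derivative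
          (Digamma (1 - z) - Digamma z) * (rGamma z * rGamma (1 - z))) (at z)"
    by (simp add: algebra_simps)
  have D2: "((\<lambda>z. sin (of_real pi * z) / of_real pi) has_field_derivative cos (of_real pi * z)) (at z)"
    by (auto intro!: derivative_eq_intros)
  have "(Digamma (1 - z) - Digamma z) * (sin (of_real pi * z) / of_real pi) = cos (of_real pi * z)"
    using DERIV_unique[OF D1[unfolded rGamma_reflection_complex] D2] .
  then have "(Digamma (1 - z) - Digamma z) * sin (of_real pi * z) = of_real pi * cos (of_real pi * z)"
    by (simp add: divide_eq_eq mult.commute)
  then show ?thesis
    using sin_pi_times_nonzero[OF assms] by (simp add: cot_def eq_divide_eq)
qed

text \<open>The alternating sum splits into two digamma series, and pairing \<open>z\<close> with \<open>1 - z\<close> leaves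
  \<open>(cot (\<pi> z / 2) + tan (\<pi> z / 2)) / 2\<close>.\<close>

lemma cosec_partial_fractions:
  fixes z :: complex
  assumes z: "z \<notin> \<int>"
  shows "(\<lambda>k. (-1) ^ k * (1 / (z + of_nat k) + 1 / (of_nat k + 1 - z)))
           sums (of_real pi / sin (of_real pi * z))"
proof -
  define X :: "complex \<Rightarrow> nat \<Rightarrow> complex"
    where "X z n = (\<Sum>k<n. (-1) ^ k * (1 / (z + of_nat k)))" for z n
  have lim: "X z \<longlonglongrightarrow> (Digamma ((z + 1) / 2) - Digamma (z / 2)) / 2" if z: "z \<notin> \<int>" for z
  proof (rule LIMSEQ_even_odd)
    have nz: "z \<noteq> 0" "z + 1 \<noteq> 0"
      using z by (auto simp: add_eq_0_iff2)
    \<comment> \<open>Terms of even index belong to the digamma series at \<open>z / 2\<close>,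
      those of odd index to the one at \<open>(z + 1) / 2\<close>. The logarithm is added and
      subtracted so that \<open>Digamma_LIMSEQ\<close> applies to each.\<close>
    have "X z (2 * n) = ((of_real (ln (real n)) - (\<Sum>k<n. inverse ((z + 1) / 2 + of_nat k)))
              - (of_real (ln (real n)) - (\<Sum>k<n. inverse (z / 2 + of_nat k)))) / 2" for n
    proof (induction n)
      case (Suc n)
      have inv: "inverse (z / 2 + of_nat n) = 2 * (1 / (z + of_nat (2 * n)))"
           "inverse ((z + 1) / 2 + of_nat n) = 2 * (1 / (z + of_nat (2 * n + 1)))"
        by (simp_all add: inverse_eq_divide add_divide_distrib[symmetric] add_ac add_divide_eq_iff)
      have step: "X z (2 * Suc n) = X z (2 * n) + 1 / (z + of_nat (2 * n)) - 1 / (z + of_nat (2 * n + 1))"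
        by (simp add: X_def)
      \<comment> \<open>The induction step in free variables, which keeps simplification away from
        the sums; \<open>q\<close> and \<open>r\<close> stand for the cancelling logarithms.\<close>
      have "p = (q - S - (q - T)) / 2 \<Longrightarrow> p + a - b = (r - (S + 2 * b) - (r - (T + 2 * a))) / 2"
        for a b p q r S T :: complex
        by (simp add: algebra_simps add_divide_distrib diff_divide_distrib)
      from this[OF Suc.IH] show ?case
        unfolding step inv sum.lessThan_Suc .
    qed (simp add: X_def)
    then show even: "(\<lambda>n. X z (2 * n)) \<longlonglongrightarrow> (Digamma ((z + 1) / 2) - Digamma (z / 2)) / 2"
      using nz by (simp only:) (intro tendsto_intros Digamma_LIMSEQ; simp)
    have "(\<lambda>n. 1 / (z + of_nat n)) \<longlonglongrightarrow> 0"
      by (intro tendsto_divide_0[OF tendsto_const] tendsto_add_filterlim_at_infinity[OF tendsto_const]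
            tendsto_of_nat)
    then have "(\<lambda>n. 1 / (z + of_nat (2 * n))) \<longlonglongrightarrow> 0"
      by (rule LIMSEQ_subseq_LIMSEQ[unfolded o_def]) (simp add: strict_mono_def)
    from tendsto_add[OF even this]
    show "(\<lambda>n. X z (2 * n + 1)) \<longlonglongrightarrow> (Digamma ((z + 1) / 2) - Digamma (z / 2)) / 2"
      by (simp add: X_def)
  qed
  have z': "1 - z \<notin> \<int>"
    using z Ints_diff[of 1 "1 - z"] by auto
  have half: "w / 2 \<notin> \<int>" if "w \<notin> \<int>" for w :: complex
    using that Ints_mult[of 2 "w / 2"] by auto
  note z2 = half[OF z] half[OF z']
  have "(\<lambda>n. X z n + X (1 - z) n) \<longlonglongrightarrow>
          (Digamma ((z + 1) / 2) - Digamma (z / 2)) / 2 + (Digamma ((1 - z + 1) / 2) - Digamma ((1 - z) / 2)) / 2"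
    by (intro tendsto_add lim z z')
  \<comment> \<open>Since \<open>(z + 1) / 2 = 1 - (1 - z) / 2\<close> and
    \<open>(1 - z + 1) / 2 = 1 - z / 2\<close>, exchanging terms between the differences produces
    two reflection pairs.\<close>
  also have "(Digamma ((z + 1) / 2) - Digamma (z / 2)) / 2 + (Digamma ((1 - z + 1) / 2) - Digamma ((1 - z) / 2)) / 2
     = ((Digamma (1 - z / 2) - Digamma (z / 2)) + (Digamma (1 - (1 - z) / 2) - Digamma ((1 - z) / 2))) / 2"
    by (simp add: field_simps)
  also have "\<dots> = (of_real pi * cot (of_real pi * (z / 2)) + of_real pi * cot (of_real pi * ((1 - z) / 2))) / 2"
    by (simp only: Digamma_reflection_complex[OF z2(1)] Digamma_reflection_complex[OF z2(2)])
  also have "\<dots> = of_real pi / sin (of_real pi * z)"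
  proof -
    define w where "w = of_real pi * (z / 2)"
    have w: "of_real pi * ((1 - z) / 2) = of_real pi / 2 - w" "of_real pi * z = 2 * w"
      by (simp_all add: w_def field_simps)
    have "sin (2 * w) \<noteq> 0"
      unfolding w(2)[symmetric] using z by (rule sin_pi_times_nonzero)
    then have nz: "sin w \<noteq> 0" "cos w \<noteq> 0"
      by (auto simp: sin_double)
    have c: "cot (of_real pi / 2 - w) = sin w / cos w"
      by (simp add: cot_def sin_diff cos_diff)
    have "cos w * cos w = 1 - sin w * sin w"
      using sin_cos_squared_add[of w] by (simp add: power2_eq_square algebra_simps)
    then have d: "cos w / sin w + sin w / cos w = 2 / (2 * sin w * cos w)"
      using nz by (simp add: field_simps)
    show ?thesis
      unfolding w w_def[symmetric] sin_double c unfolding cot_def distrib_left[symmetric] d by simp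
  qed
  finally show ?thesis
    unfolding sums_def X_def sum.distrib[symmetric] distrib_left[symmetric]
    by (simp add: algebra_simps)
qed

text \<open>The cosecant series at \<open>z = 1 / 2 + w / pi\<close>, where
  \<open>sin (pi * z) = cos w\<close>. The two fractions in its \<open>n\<close>-th term have
  denominators \<open>(node n + w) / pi\<close> and \<open>(node n - w) / pi\<close>.\<close>

lemma sec_partial_fractions:
  fixes w :: complex
  assumes "cos w \<noteq> 0"
  shows "(\<lambda>n. (-1) ^ n * (2 * of_real (node n) / ((of_real (node n))\<^sup>2 - w\<^sup>2))) sums (1 / cos w)"
proof -
  define z where "z = 1 / 2 + w / of_real pi"
  have wz: "of_real pi * z = w + of_real pi / 2"
    by (simp add: z_def field_simps)
  have s: "sin (of_real pi * z) = cos w"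
    unfolding wz by (simp add: sin_add)
  have "z \<notin> \<int>"
    using assms unfolding s[symmetric] by (auto elim!: Ints_cases simp: sin_eq_0 mult.commute)
  from sums_divide[OF cosec_partial_fractions[OF this], of "of_real pi"]
  have "(\<lambda>n. (-1) ^ n * (1 / (z + of_nat n) + 1 / (of_nat n + 1 - z)) / of_real pi) sums (1 / cos w)"
    by (simp add: s)
  moreover have "(1 / (z + of_nat n) + 1 / (of_nat n + 1 - z)) / of_real pi
      = 2 * of_real (node n) / ((of_real (node n))\<^sup>2 - w\<^sup>2)" for n
  proof -
    have a: "z + of_nat n = (of_real (node n) + w) / of_real pi"
            "of_nat n + 1 - z = (of_real (node n) - w) / of_real pi"
      by (simp_all add: z_def node_def field_simps)
    have "z + of_nat n \<noteq> 0" "of_nat n + 1 - z \<noteq> 0"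
      using \<open>z \<notin> \<int>\<close> Ints_diff[of "z + of_nat n" "of_nat n"] Ints_diff[of "of_nat n + 1" "of_nat n + 1 - z"]
      by (metis Ints_0 Ints_of_nat add_diff_cancel_left' diff_zero add_diff_cancel_right' Ints_1 Ints_add diff_diff_eq2)+
    then have "of_real (node n) + w \<noteq> 0" "of_real (node n) - w \<noteq> 0"
      unfolding a by auto
    then show ?thesis
      unfolding a by (simp add: power2_eq_square square_diff_square_factored add_frac_eq distrib_left[symmetric])
  qed
  ultimately show ?thesis
    by (simp add: mult.assoc[symmetric] times_divide_eq_right[symmetric] del: times_divide_eq_right)
qed

text \<open>The secant series on the imaginary axis: \<open>w = \<i> * t\<close> turns
  \<open>cos w\<close> into \<open>cosh t\<close> and \<open>- w^2\<close> into \<open>t^2\<close>,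
  so no pole is met.\<close>

lemma sech_partial_fractions:
  fixes t :: real
  shows "(\<lambda>n. (-1) ^ n * (2 * node n / ((node n)\<^sup>2 + t\<^sup>2))) sums (1 / cosh t)"
proof -
  have c: "cos (\<i> * of_real t) = complex_of_real (cosh t)"
    by (simp add: cosh_def cos_exp_eq scaleR_conv_of_real flip: exp_of_real of_real_minus)
  have "cosh t \<noteq> 0"
    using cosh_real_pos[of t] by linarith
  then have "cos (\<i> * of_real t) \<noteq> 0"
    by (simp add: c)
  from sec_partial_fractions[OF this] have
    "(\<lambda>n. complex_of_real ((-1) ^ n * (2 * node n / ((node n)\<^sup>2 + t\<^sup>2)))) sums complex_of_real (1 / cosh t)"
    by (simp add: c power_mult_distrib)
  then show ?thesis
    by (simp only: sums_of_real_iff)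
qed

lemma node_pos: "node n > 0"
  by (simp add: node_def)

lemma node_ge_1: "1 \<le> node n"
proof -
  have "1 \<le> pi * (1 / 2)" using pi_gt3 by simp
  also have "\<dots> \<le> node n" unfolding node_def by (intro mult_left_mono) auto
  finally show ?thesis .
qed

text \<open>Summation by parts: the differences of consecutive terms are \<open>O(1 / n\<^sup>2)\<close> uniformly in \<open>t\<close>. The
  bound supplies the dominating function when the alternating series is integrated termwise.\<close>

lemma sech_partial_sums_bounded:
  obtains C where "\<And>N t. \<bar>\<Sum>n<N. (-1) ^ n * (2 * node n / ((node n)\<^sup>2 + t\<^sup>2))\<bar> \<le> C"
proof -
  define b where "b t n = 2 * node n / ((node n)\<^sup>2 + t\<^sup>2)" for t n
  have step: "\<bar>b t (Suc n) - b t n\<bar> \<le> 8 * inverse (real (Suc n)) ^ 2" for t n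
  proof -
    have pos: "node n > 0" "node (Suc n) > 0" by (rule node_pos)+
    have Suc: "node (Suc n) = node n + pi" by (simp add: node_def algebra_simps)
    have pos': "(node n)\<^sup>2 + t\<^sup>2 > 0" "(node (Suc n))\<^sup>2 + t\<^sup>2 > 0"
      using pos by (simp_all add: add_pos_nonneg)
    have eq: "b t (Suc n) - b t n = 2 * pi * (t\<^sup>2 - node n * node (Suc n)) / (((node n)\<^sup>2 + t\<^sup>2) * ((node (Suc n))\<^sup>2 + t\<^sup>2))"
    proof -
      have "b t (Suc n) - b t n = (2 * node (Suc n) * ((node n)\<^sup>2 + t\<^sup>2) - 2 * node n * ((node (Suc n))\<^sup>2 + t\<^sup>2)) / (((node n)\<^sup>2 + t\<^sup>2) * ((node (Suc n))\<^sup>2 + t\<^sup>2))"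
        unfolding b_def using pos' by (subst diff_frac_eq) auto
      also have "2 * node (Suc n) * ((node n)\<^sup>2 + t\<^sup>2) - 2 * node n * ((node (Suc n))\<^sup>2 + t\<^sup>2) = 2 * (node (Suc n) - node n) * (t\<^sup>2 - node n * node (Suc n))"
        by (simp add: algebra_simps power2_eq_square)
      finally show ?thesis by (simp add: Suc)
    qed
    \<comment> \<open>This cancels the factor with \<open>node (Suc n)\<close> from the denominator
      and leads to a bound free of \<open>t\<close>.\<close>
    have "\<bar>t\<^sup>2 - node n * node (Suc n)\<bar> \<le> (node (Suc n))\<^sup>2 + t\<^sup>2"
    proof -
      have "node n * node (Suc n) \<le> (node (Suc n))\<^sup>2"
        using pos by (simp add: Suc power2_eq_square)
      moreover have "0 \<le> node n * node (Suc n)" using pos by simp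
      ultimately show ?thesis by (smt (verit) zero_le_power2)
    qed
    then have "\<bar>b t (Suc n) - b t n\<bar> \<le> 2 * pi * ((node (Suc n))\<^sup>2 + t\<^sup>2) / (((node n)\<^sup>2 + t\<^sup>2) * ((node (Suc n))\<^sup>2 + t\<^sup>2))"
      unfolding eq abs_mult abs_divide using pos'
      by (intro frac_le mult_mono) (auto simp: abs_mult simp del: mult_le_cancel_left)
    also have "\<dots> = 2 * pi / ((node n)\<^sup>2 + t\<^sup>2)"
      using pos'(2) by (intro nonzero_mult_divide_mult_cancel_right) (metis less_irrefl)
    also have "\<dots> \<le> 2 * pi / (node n)\<^sup>2"
      using pos by (intro divide_left_mono) (auto simp: add_pos_nonneg)
    also have "\<dots> \<le> 2 * pi / (pi * (real (Suc n) / 2))\<^sup>2"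
      using pos by (intro divide_left_mono power_mono) (auto simp: node_def)
    also have "\<dots> = 8 / pi * inverse (real (Suc n)) ^ 2"
      by (simp add: power2_eq_square field_simps del: of_nat_Suc)
    also have "\<dots> \<le> 8 * inverse (real (Suc n)) ^ 2"
      using pi_gt3 by (intro mult_right_mono) (simp_all add: divide_le_eq)
    finally show ?thesis .
  qed
  have summ: "summable (\<lambda>n. 8 * inverse (real (Suc n)) ^ 2)"
    using inverse_power_summable[of 2, where 'a = real] summable_Suc_iff[of "\<lambda>n. inverse (real n ^ 2)"]
    by (intro summable_mult) (simp add: power_inverse del: of_nat_Suc)
  define D where "D = (\<Sum>n. 8 * inverse (real (Suc n)) ^ 2)"
  have b: "0 \<le> b t n" "b t n \<le> 2" for t n
  proof -
    have "b t n \<le> 2 * node n / (node n)\<^sup>2"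
      unfolding b_def using node_pos[of n] by (intro divide_left_mono) (auto simp: add_pos_nonneg)
    also have "\<dots> = 2 / node n"
      by (simp add: power2_eq_square)
    also have "\<dots> \<le> 2 / 1"
      using node_ge_1[of n] by (intro divide_left_mono) auto
    finally show "b t n \<le> 2" by simp
    show "0 \<le> b t n"
      unfolding b_def using node_pos[of n] by (auto simp: less_imp_le intro!: divide_nonneg_nonneg)
  qed
  \<comment> \<open>The sum added to its own shift by one index leaves consecutive differences and
    two boundary terms.\<close>
  have eq: "2 * (\<Sum>n<N. (-1) ^ n * b t n) = b t 0 - (-1) ^ N * b t N + (\<Sum>n<N. (-1) ^ n * (b t n - b t (Suc n)))" for N t
    by (induction N) (auto simp: algebra_simps)
  have "\<bar>\<Sum>n<N. (-1) ^ n * b t n\<bar> \<le> 4 + D" for N t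
  proof -
    have "\<bar>\<Sum>n<N. (-1) ^ n * (b t n - b t (Suc n))\<bar> \<le> (\<Sum>n<N. 8 * inverse (real (Suc n)) ^ 2)"
      using step by (intro order.trans[OF sum_abs] sum_mono) (simp add: abs_mult abs_minus_commute)
    also have "\<dots> \<le> D"
      unfolding D_def by (intro sum_le_suminf summ) auto
    finally have *: "\<bar>\<Sum>n<N. (-1) ^ n * (b t n - b t (Suc n))\<bar> \<le> D" .
    have "\<bar>(-1) ^ N * b t N\<bar> \<le> 2"
      using b[of t N] by (simp add: abs_mult)
    then have "\<bar>2 * (\<Sum>n<N. (-1) ^ n * b t n)\<bar> \<le> 4 + D"
      unfolding eq using * b[of t 0] by linarith
    then show ?thesis using * by (simp add: abs_mult)
  qed
  then show ?thesis
    using that unfolding b_def by blast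
qed

section \<open>Mellin integrals\<close>

lemma complex_of_real_powr_add_nat:
  assumes "t > 0"
  shows "complex_of_real t powr (c + of_nat n) = of_real t powr c * of_real (t ^ n)"
  using assms by (simp only: powr_add powr_nat' of_real_power of_real_eq_0_iff) simp

text \<open>For \<open>Re c < 1\<close> the integrand is singular at 0, hence the fundamental
  theorem with differentiability in the interior only; \<open>Re c > 0\<close> makes the primitive
  \<open>t powr c / c\<close> continuous at 0.\<close>

lemma has_integral_complex_powr_from_0:
  fixes c :: complex
  assumes "Re c > 0" "b \<ge> 0"
  shows "((\<lambda>t. of_real t powr (c - 1)) has_integral (of_real b powr c / c)) {0..b}"
proof -
  have "((\<lambda>t. complex_of_real t powr (c - 1)) has_integral
          (of_real b powr c / c - of_real 0 powr c / c)) {0..b}"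
    using assms
    by (intro fundamental_theorem_of_calculus_interior)
       (auto intro!: continuous_intros derivative_eq_intros has_vector_derivative_real_field)
  then show ?thesis by simp
qed

text \<open>The integral over \<open>[b, b + k]\<close> is elementary. Dominated convergence with
  \<open>t powr (Re c - 1)\<close> lets \<open>k\<close> tend to infinity, where
  \<open>Re c < 0\<close> kills the boundary term.\<close>

lemma has_integral_complex_powr_to_inf:
  fixes c :: complex
  assumes c: "Re c < 0" and b: "b > 0"
  shows "((\<lambda>t. of_real t powr (c - 1)) has_integral - (of_real b powr c / c)) {b..}"
proof (rule has_integral_dominated_convergence)
  define f where "f k t = (if t \<in> {b..b + real k} then complex_of_real t powr (c - 1) else 0)" for k t
  have "c \<noteq> 0" using c by auto
  show "(f k has_integral (of_real (b + real k) powr c / c - of_real b powr c / c)) {b..}" for k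
  proof -
    have "((\<lambda>t. complex_of_real t powr (c - 1)) has_integral
            (of_real (b + real k) powr c / c - of_real b powr c / c)) {b..b + real k}"
      using b \<open>c \<noteq> 0\<close>
      by (intro fundamental_theorem_of_calculus_interior)
         (auto intro!: continuous_intros derivative_eq_intros has_vector_derivative_real_field)
    then show ?thesis
      unfolding f_def by (subst has_integral_restrict) auto
  qed
  show "(\<lambda>t. t powr (Re c - 1)) integrable_on {b..}"
    using has_integral_powr_to_inf[of "Re c - 1" b] c b by (auto simp: integrable_on_def)
  show "\<forall>t\<in>{b..}. norm (f k t) \<le> t powr (Re c - 1)" for k
    using b by (auto simp: f_def norm_powr_real_powr)
  show "\<forall>t\<in>{b..}. (\<lambda>k. f k t) \<longlonglongrightarrow> of_real t powr (c - 1)"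
  proof
    fix t assume t: "t \<in> {b..}"
    have "eventually (\<lambda>k. t - b \<le> real k) sequentially"
      by (rule eventually_sequentiallyI[of "nat \<lceil>t - b\<rceil>"]) linarith
    then have "eventually (\<lambda>k. f k t = of_real t powr (c - 1)) sequentially"
      by (rule eventually_mono) (use t in \<open>auto simp: f_def\<close>)
    then show "(\<lambda>k. f k t) \<longlonglongrightarrow> of_real t powr (c - 1)"
      by (rule tendsto_eventually)
  qed
  have "filterlim (\<lambda>k. b + real k) at_top sequentially"
    by (intro filterlim_tendsto_add_at_top[OF tendsto_const] filterlim_real_sequentially)
  note lim = tendsto_neg_powr_complex_of_real[OF this c]
  from tendsto_diff[OF tendsto_divide[OF lim tendsto_const[of c] \<open>c \<noteq> 0\<close>] tendsto_const[of "of_real b powr c / c"]]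
  show "(\<lambda>k. of_real (b + real k) powr c / c - of_real b powr c / c) \<longlonglongrightarrow> - (of_real b powr c / c)"
    by simp
qed

section \<open>The geometric expansion of 1 / (t^2 + b^2) on either side of t = b\<close>

lemma alternating_geometric_sum_bound:
  fixes x :: real
  assumes "0 \<le> x" "x \<le> 1"
  shows "\<bar>\<Sum>k<n. (- x) ^ k\<bar> \<le> 2"
proof -
  \<comment> \<open>The ratio is negative, so the denominator \<open>1 + x\<close> is at least 1 and
    the bound stays uniform up to \<open>x = 1\<close>, where the series itself diverges.\<close>
  have "(\<Sum>k<n. (- x) ^ k) = (1 - (- x) ^ n) / (1 + x)"
    using assms by (subst sum_gp_strict) auto
  moreover have "\<bar>1 - (- x) ^ n\<bar> \<le> 2"
  proof -
    have "\<bar>(- x) ^ n\<bar> \<le> 1"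
      using assms by (simp add: power_abs power_le_one)
    then show ?thesis by linarith
  qed
  ultimately have "\<bar>\<Sum>k<n. (- x) ^ k\<bar> \<le> 2 / (1 + x)"
    using assms by (simp add: divide_right_mono)
  also have "\<dots> \<le> 2"
    using assms by (simp add: divide_le_eq)
  finally show ?thesis .
qed

lemma alternating_geometric_sums:
  fixes x :: real
  assumes "0 \<le> x" "x < 1"
  shows "(\<lambda>n. \<Sum>k<n. (- x) ^ k) \<longlonglongrightarrow> 1 / (1 + x)"
  using geometric_sums[of "- x"] assms by (simp add: sums_def)

text \<open>Termwise integration of the expansion in powers of \<open>- (t / b)^2\<close>. It
  diverges at \<open>t = b\<close>, so the work is done on the open interval; its partial sums are
  bounded by 2, which leaves a multiple of \<open>t powr (Re c - 1)\<close> as majorant.\<close>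

lemma integral_powr_over_quadratic_left:
  fixes c :: complex
  assumes c: "0 < Re c" and b: "b > 0"
  defines "g \<equiv> \<lambda>t. of_real t powr (c - 1) / of_real (t\<^sup>2 + b\<^sup>2)"
  shows "g integrable_on {0..b}"
    and "(\<lambda>n. of_real b powr (c - 2) * (\<Sum>k<n. (-1) ^ k / (c + of_nat (2 * k)))) \<longlonglongrightarrow> integral {0..b} g"
proof -
  define f where "f n t = of_real t powr (c - 1) / of_real (b\<^sup>2) * of_real (\<Sum>k<n. (- (t / b)\<^sup>2) ^ k)"
    for n and t :: real
  have int: "(f n has_integral of_real b powr (c - 2) * (\<Sum>k<n. (-1) ^ k / (c + of_nat (2 * k)))) {0<..<b}" for n
  proof -
    have "((\<lambda>t. \<Sum>k<n. (-1) ^ k / of_real (b ^ (2 * k + 2)) * of_real t powr (c + of_nat (2 * k) - 1)) has_integral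
       (\<Sum>k<n. (-1) ^ k / of_real (b ^ (2 * k + 2)) * (of_real b powr (c + of_nat (2 * k)) / (c + of_nat (2 * k))))) {0..b}"
      using c b by (intro has_integral_sum has_integral_mult_right has_integral_complex_powr_from_0) auto
    also have "(\<Sum>k<n. (-1) ^ k / of_real (b ^ (2 * k + 2)) * (of_real b powr (c + of_nat (2 * k)) / (c + of_nat (2 * k)))) =
      of_real b powr (c - 2) * (\<Sum>k<n. (-1) ^ k / (c + of_nat (2 * k)))"
      unfolding sum_distrib_left
    proof (intro sum.cong refl)
      fix k
      have "of_real b powr (c + of_nat (2 * k)) = of_real b powr (c - 2) * of_real (b ^ (2 * k + 2))"
        using complex_of_real_powr_add_nat[OF b, of "c - 2" "2 * k + 2"] by simp
      then show "(-1) ^ k / of_real (b ^ (2 * k + 2)) * (of_real b powr (c + of_nat (2 * k)) / (c + of_nat (2 * k)))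
          = of_real b powr (c - 2) * ((-1) ^ k / (c + of_nat (2 * k)))"
        using b by simp
    qed
    finally show ?thesis
      unfolding has_integral_Icc_iff_Ioo
    proof (rule has_integral_eq[rotated])
      fix t assume t: "t \<in> {0<..<b}"
      have "of_real t powr (c + of_nat (2 * k) - 1) = of_real t powr (c - 1) * of_real (t ^ (2 * k))" for k
        using complex_of_real_powr_add_nat[of t "c - 1" "2 * k"] t by (simp add: algebra_simps)
      moreover have "(- (t / b)\<^sup>2) ^ k = (- 1) ^ k * t ^ (2 * k) / b ^ (2 * k)" for k
        by (simp add: power_minus[of "t\<^sup>2 / b\<^sup>2"] power_divide power_mult)
      ultimately show "(\<Sum>k<n. (-1) ^ k / of_real (b ^ (2 * k + 2)) * of_real t powr (c + of_nat (2 * k) - 1)) = f n t"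
        unfolding f_def of_real_sum sum_distrib_left
        by (intro sum.cong refl)
           (simp add: power2_eq_square mult_ac)
    qed
  qed
  have lim: "(\<lambda>n. f n t) \<longlonglongrightarrow> g t" if "t \<in> {0<..<b}" for t
  proof -
    have "(t / b)\<^sup>2 < 1"
      using that by (simp add: power_less_one_iff)
    then have "(\<lambda>n. f n t) \<longlonglongrightarrow> of_real t powr (c - 1) / of_real (b\<^sup>2) * of_real (1 / (1 + (t / b)\<^sup>2))"
      unfolding f_def by (intro tendsto_mult tendsto_const tendsto_of_real alternating_geometric_sums) auto
    also have "of_real t powr (c - 1) / of_real (b\<^sup>2) * of_real (1 / (1 + (t / b)\<^sup>2))
        = of_real t powr (c - 1) * complex_of_real (1 / b\<^sup>2 * (1 / (1 + (t / b)\<^sup>2)))"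
      by simp
    also have "1 / b\<^sup>2 * (1 / (1 + (t / b)\<^sup>2)) = 1 / (t\<^sup>2 + b\<^sup>2)"
      using b by (simp add: power_divide distrib_left add.commute)
    finally show ?thesis
      by (simp add: g_def)
  qed
  have bound: "norm (f n t) \<le> 2 / b\<^sup>2 * t powr (Re c - 1)" if "t \<in> {0<..<b}" for n t
  proof -
    have "\<bar>\<Sum>k<n. (- (t / b)\<^sup>2) ^ k\<bar> \<le> 2"
      using that by (intro alternating_geometric_sum_bound) (auto simp: power_le_one_iff)
    then have "norm (f n t) \<le> t powr (Re c - 1) / b\<^sup>2 * 2"
      unfolding f_def norm_mult norm_divide using that
      by (intro mult_mono) (auto simp: norm_powr_real_powr norm_power simp del: of_real_sum)
    then show ?thesis by (simp add: mult.commute)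
  qed
  have dom: "(\<lambda>t. 2 / b\<^sup>2 * t powr (Re c - 1)) integrable_on {0<..<b}"
    using has_integral_powr_from_0[of "Re c - 1" b] c b
    unfolding has_integral_Icc_iff_Ioo by (intro integrable_on_mult_right) (auto simp: integrable_on_def)
  have "f n integrable_on {0<..<b}" for n
    using int by (auto simp: integrable_on_def)
  note dc = dominated_convergence[OF this dom bound lim]
  from dc(1) show g: "g integrable_on {0..b}"
    unfolding integrable_on_def has_integral_Icc_iff_Ioo .
  have "integral {0..b} g = integral {0<..<b} g"
    using g dc(1) by (metis has_integral_Icc_iff_Ioo integrable_integral integral_unique)
  with dc(2) show "(\<lambda>n. of_real b powr (c - 2) * (\<Sum>k<n. (-1) ^ k / (c + of_nat (2 * k)))) \<longlonglongrightarrow> integral {0..b} g"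
    by (simp add: integral_unique[OF int])
qed

lemma has_integral_Ici_iff_Ioi:
  fixes f :: "real \<Rightarrow> 'a :: banach"
  shows "(f has_integral y) {b..} \<longleftrightarrow> (f has_integral y) {b<..}"
proof (rule has_integral_spike_set_eq)
  show "negligible {x \<in> {b..} - {b<..}. f x \<noteq> 0}"
    by (rule negligible_subset[of "{b}"]) auto
  show "negligible {x \<in> {b<..} - {b..}. f x \<noteq> 0}"
    by (rule negligible_subset[of "{}"]) auto
qed

text \<open>The counterpart for \<open>t > b\<close>, with an expansion in powers of
  \<open>- (b / t)^2\<close>. Its majorant is a multiple of \<open>t powr (Re c - 3)\<close>,
  integrable at infinity because \<open>Re c < 2\<close>.\<close>

lemma integral_powr_over_quadratic_right:
  fixes c :: complex
  assumes c: "Re c < 2" and b: "b > 0"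
  defines "g \<equiv> \<lambda>t. of_real t powr (c - 1) / of_real (t\<^sup>2 + b\<^sup>2)"
  shows "g integrable_on {b..}"
    and "(\<lambda>n. of_real b powr (c - 2) * (\<Sum>k<n. (-1) ^ k / (of_nat (2 * k) + 2 - c))) \<longlonglongrightarrow> integral {b..} g"
proof -
  define f where "f n t = of_real t powr (c - 3) * of_real (\<Sum>k<n. (- (b / t)\<^sup>2) ^ k)"
    for n and t :: real
  have int: "(f n has_integral of_real b powr (c - 2) * (\<Sum>k<n. (-1) ^ k / (of_nat (2 * k) + 2 - c))) {b<..}" for n
  proof -
    have "((\<lambda>t. \<Sum>k<n. (-1) ^ k * of_real (b ^ (2 * k)) * of_real t powr ((c - 2 - of_nat (2 * k)) - 1)) has_integral
       (\<Sum>k<n. (-1) ^ k * of_real (b ^ (2 * k)) * - (of_real b powr (c - 2 - of_nat (2 * k)) / (c - 2 - of_nat (2 * k))))) {b..}"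
      using c b by (intro has_integral_sum has_integral_mult_right has_integral_complex_powr_to_inf) auto
    also have "(\<Sum>k<n. (-1) ^ k * of_real (b ^ (2 * k)) * - (of_real b powr (c - 2 - of_nat (2 * k)) / (c - 2 - of_nat (2 * k)))) =
      of_real b powr (c - 2) * (\<Sum>k<n. (-1) ^ k / (of_nat (2 * k) + 2 - c))"
      unfolding sum_distrib_left
    proof (intro sum.cong refl)
      fix k
      have "of_real b powr (c - 2) = of_real b powr (c - 2 - of_nat (2 * k)) * of_real (b ^ (2 * k))"
        using complex_of_real_powr_add_nat[OF b, of "c - 2 - of_nat (2 * k)" "2 * k"] by simp
      moreover have "- (x / (c - 2 - of_nat (2 * k))) = x / (of_nat (2 * k) + 2 - c)" for x
        unfolding minus_divide_right by (simp add: algebra_simps)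
      ultimately show "(-1) ^ k * of_real (b ^ (2 * k)) * - (of_real b powr (c - 2 - of_nat (2 * k)) / (c - 2 - of_nat (2 * k)))
          = of_real b powr (c - 2) * ((-1) ^ k / (of_nat (2 * k) + 2 - c))"
        by simp
    qed
    finally show ?thesis
      unfolding has_integral_Ici_iff_Ioi
    proof (rule has_integral_eq[rotated])
      fix t assume "t \<in> {b<..}"
      then have t: "t > 0" using b by auto
      have "of_real t powr ((c - 2 - of_nat (2 * k)) - 1) = of_real t powr (c - 3) / of_real (t ^ (2 * k))" for k
        using complex_of_real_powr_add_nat[OF t, of "c - 2 - of_nat (2 * k) - 1" "2 * k"] t
        by (simp add: algebra_simps)
      moreover have "(- (b / t)\<^sup>2) ^ k = (- 1) ^ k * b ^ (2 * k) / t ^ (2 * k)" for k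
        by (simp add: power_minus[of "b\<^sup>2 / t\<^sup>2"] power_divide power_mult)
      ultimately show "(\<Sum>k<n. (-1) ^ k * of_real (b ^ (2 * k)) * of_real t powr ((c - 2 - of_nat (2 * k)) - 1)) = f n t"
        unfolding f_def of_real_sum sum_distrib_left
        by (intro sum.cong refl)
           (simp add: mult_ac)
    qed
  qed
  have lim: "(\<lambda>n. f n t) \<longlonglongrightarrow> g t" if "t \<in> {b<..}" for t
  proof -
    have t: "t > 0" using that b by auto
    have "(b / t)\<^sup>2 < 1"
      using that b by (simp add: power_less_one_iff)
    then have "(\<lambda>n. f n t) \<longlonglongrightarrow> of_real t powr (c - 3) * of_real (1 / (1 + (b / t)\<^sup>2))"
      unfolding f_def by (intro tendsto_mult tendsto_const tendsto_of_real alternating_geometric_sums) auto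
    also have "of_real t powr (c - 3) = of_real t powr (c - 1) / of_real (t\<^sup>2)"
      using complex_of_real_powr_add_nat[OF t, of "c - 3" 2] t by simp
    also have "\<dots> * of_real (1 / (1 + (b / t)\<^sup>2))
        = of_real t powr (c - 1) * complex_of_real (1 / t\<^sup>2 * (1 / (1 + (b / t)\<^sup>2)))"
      by simp
    also have "1 / t\<^sup>2 * (1 / (1 + (b / t)\<^sup>2)) = 1 / (t\<^sup>2 + b\<^sup>2)"
      using t by (simp add: power_divide distrib_left)
    finally show ?thesis
      by (simp add: g_def)
  qed
  have bound: "norm (f n t) \<le> 2 * t powr (Re c - 3)" if "t \<in> {b<..}" for n t
  proof -
    have "\<bar>\<Sum>k<n. (- (b / t)\<^sup>2) ^ k\<bar> \<le> 2"
      using that b by (intro alternating_geometric_sum_bound) (auto simp: power_le_one_iff)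
    then have "norm (f n t) \<le> t powr (Re c - 3) * 2"
      unfolding f_def norm_mult using that b
      by (intro mult_mono) (auto simp: norm_powr_real_powr simp del: of_real_sum)
    then show ?thesis by (simp add: mult.commute)
  qed
  have dom: "(\<lambda>t. 2 * t powr (Re c - 3)) integrable_on {b<..}"
    using has_integral_powr_to_inf[of "Re c - 3" b] c b
    unfolding has_integral_Ici_iff_Ioi by (intro integrable_on_mult_right) (auto simp: integrable_on_def)
  have "f n integrable_on {b<..}" for n
    using int by (auto simp: integrable_on_def)
  note dc = dominated_convergence[OF this dom bound lim]
  from dc(1) show g: "g integrable_on {b..}"
    unfolding integrable_on_def has_integral_Ici_iff_Ioi .
  have "integral {b..} g = integral {b<..} g"
    using g dc(1) by (metis has_integral_Ici_iff_Ioi integrable_integral integral_unique)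
  with dc(2) show "(\<lambda>n. of_real b powr (c - 2) * (\<Sum>k<n. (-1) ^ k / (of_nat (2 * k) + 2 - c))) \<longlonglongrightarrow> integral {b..} g"
    by (simp add: integral_unique[OF int])
qed

lemma half_notin_Ints:
  fixes c :: complex
  assumes "0 < Re c" "Re c < 2"
  shows "c / 2 \<notin> \<int>"
proof
  assume "c / 2 \<in> \<int>"
  then obtain n :: int where "c / 2 = of_int n" by (elim Ints_cases)
  then have "Re (c / 2) = of_int n" by simp
  then show False using assms by simp
qed

text \<open>Expanding \<open>1 / (t\<^sup>2 + b\<^sup>2)\<close> as a geometric series on either side of \<open>t = b\<close> turns the integral
  into the partial fraction series of the cosecant; only the sum of the two halves is elementary.\<close>

lemma has_integral_powr_over_quadratic:
  fixes c :: complex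
  assumes c: "0 < Re c" "Re c < 2" and b: "b > 0"
  shows "((\<lambda>t. of_real t powr (c - 1) / of_real (t\<^sup>2 + b\<^sup>2)) has_integral
           of_real pi / (2 * sin (of_real pi * c / 2)) * of_real b powr (c - 2)) {0..}"
proof -
  define g where "g t = of_real t powr (c - 1) / of_real (t\<^sup>2 + b\<^sup>2)" for t :: real
  note left = integral_powr_over_quadratic_left[OF c(1) b, folded g_def]
  note right = integral_powr_over_quadratic_right[OF c(2) b, folded g_def]
  have "(\<lambda>n. of_real b powr (c - 2) * (\<Sum>k<n. (-1) ^ k / (c + of_nat (2 * k))) +
           of_real b powr (c - 2) * (\<Sum>k<n. (-1) ^ k / (of_nat (2 * k) + 2 - c)))
        \<longlonglongrightarrow> integral {0..b} g + integral {b..} g"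
    by (intro tendsto_add left right)
  \<comment> \<open>The two halves together form the cosecant series at \<open>c / 2\<close> with
    doubled denominators; hence the factor \<open>1 / 2\<close> in front.\<close>
  also have "(\<lambda>n. of_real b powr (c - 2) * (\<Sum>k<n. (-1) ^ k / (c + of_nat (2 * k))) +
           of_real b powr (c - 2) * (\<Sum>k<n. (-1) ^ k / (of_nat (2 * k) + 2 - c))) =
        (\<lambda>n. of_real b powr (c - 2) / 2 *
           (\<Sum>k<n. (-1) ^ k * (1 / (c / 2 + of_nat k) + 1 / (of_nat k + 1 - c / 2))))"
  proof -
    have "1 / (c / 2 + of_nat k) = 2 * (1 / (c + of_nat (2 * k)))"
         "1 / (of_nat k + 1 - c / 2) = 2 * (1 / (of_nat (2 * k) + 2 - c))" for k
      by (simp_all add: divide_simps) (simp_all add: algebra_simps)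
    then have e: "(-1) ^ k * (1 / (c / 2 + of_nat k) + 1 / (of_nat k + 1 - c / 2)) =
        2 * ((-1) ^ k / (c + of_nat (2 * k)) + (-1) ^ k / (of_nat (2 * k) + 2 - c))" for k
      by (simp add: distrib_left mult.commute)
    show ?thesis
      by (simp only: e sum.distrib sum_distrib_left[symmetric]) (simp add: distrib_left)
  qed
  finally have "(\<lambda>n. of_real b powr (c - 2) / 2 *
           (\<Sum>k<n. (-1) ^ k * (1 / (c / 2 + of_nat k) + 1 / (of_nat k + 1 - c / 2))))
        \<longlonglongrightarrow> integral {0..b} g + integral {b..} g" .
  moreover have "(\<lambda>n. of_real b powr (c - 2) / 2 *
           (\<Sum>k<n. (-1) ^ k * (1 / (c / 2 + of_nat k) + 1 / (of_nat k + 1 - c / 2))))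
        \<longlonglongrightarrow> of_real b powr (c - 2) / 2 * (of_real pi / sin (of_real pi * (c / 2)))"
    using cosec_partial_fractions[OF half_notin_Ints[OF c]] by (intro tendsto_mult tendsto_const) (simp add: sums_def)
  ultimately have eq: "integral {0..b} g + integral {b..} g = of_real b powr (c - 2) / 2 * (of_real pi / sin (of_real pi * (c / 2)))"
    by (rule LIMSEQ_unique)
  have "(g has_integral (integral {0..b} g + integral {b..} g)) ({0..b} \<union> {b..})"
    using left(1) right(1)
    by (intro has_integral_Un integrable_integral) (auto intro: negligible_subset[of "{b}"])
  also have "{0..b} \<union> {b..} = {0..}"
    using b by auto
  finally have "(g has_integral of_real b powr (c - 2) / 2 * (of_real pi / sin (of_real pi * (c / 2)))) {0..}"
    unfolding eq .
  then show ?thesis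
    by (simp add: g_def[abs_def] mult.commute)
qed

section \<open>Gamma integrals and the Mellin transform of sech\<close>

lemma has_integral_Gamma_scaled:
  fixes z :: complex
  assumes z: "Re z > 0" and a: "a > 0"
  shows "((\<lambda>t. of_real t powr (z - 1) * of_real (exp (- (a * t)))) has_integral (Gamma z * of_real a powr (- z))) {0..}"
proof -
  define f where "f t = complex_of_real t powr (z - 1) / of_real (exp t)" for t
  have im: "(\<lambda>x. a * x) ` {0<..} = {0<..}"
  proof (intro equalityI subsetI)
    fix y :: real assume "y \<in> {0<..}"
    then show "y \<in> (\<lambda>x. a * x) ` {0<..}"
      using a by (intro image_eqI[of _ _ "y / a"]) auto
  qed (use a in auto)
  have "(\<lambda>x. \<bar>a\<bar> *\<^sub>R f (a * x)) absolutely_integrable_on {0<..} \<and>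
        integral {0<..} (\<lambda>x. \<bar>a\<bar> *\<^sub>R f (a * x)) = Gamma z \<longleftrightarrow>
        f absolutely_integrable_on ((\<lambda>x. a * x) ` {0<..}) \<and> integral ((\<lambda>x. a * x) ` {0<..}) f = Gamma z"
    by (rule has_absolute_integral_change_of_variables_real)
       (use a in \<open>auto intro!: derivative_eq_intros inj_onI\<close>)
  moreover have "f absolutely_integrable_on {0<..}"
    using absolutely_integrable_Gamma_integral'[OF z] unfolding f_def .
  moreover have "integral {0<..} f = Gamma z"
    using integral_unique[OF Gamma_integral_complex'[OF z]] unfolding f_def .
  ultimately have "(\<lambda>x. \<bar>a\<bar> *\<^sub>R f (a * x)) absolutely_integrable_on {0<..}"
        "integral {0<..} (\<lambda>x. \<bar>a\<bar> *\<^sub>R f (a * x)) = Gamma z"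
    unfolding im by auto
  then have "((\<lambda>x. \<bar>a\<bar> *\<^sub>R f (a * x)) has_integral Gamma z) {0<..}"
    by (metis set_lebesgue_integral_eq_integral(1) integrable_integral)
  \<comment> \<open>The substitution in Euler's integral produces
    \<open>a * a powr (z - 1) = a powr z\<close>, which the factor \<open>a powr (- z)\<close>
    removes.\<close>
  then have "((\<lambda>x. of_real a powr (- z) * (\<bar>a\<bar> *\<^sub>R f (a * x))) has_integral (of_real a powr (- z) * Gamma z)) {0<..}"
    by (rule has_integral_mult_right)
  then show ?thesis
    unfolding has_integral_Ici_iff_Ioi mult.commute[of "Gamma z"]
  proof (rule has_integral_eq[rotated])
    fix t :: real assume t: "t \<in> {0<..}"
    have "of_real a powr (- z) * of_real a * of_real a powr (z - 1) = complex_of_real a powr (- z + (z - 1)) * of_real a"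
      using a by (simp only: powr_add) (simp add: mult_ac)
    also have "\<dots> = 1"
      using a by (simp add: powr_minus)
    finally have a1: "of_real a powr (- z) * of_real a * complex_of_real a powr (z - 1) = 1" .
    have "complex_of_real (a * t) powr (z - 1) = of_real a powr (z - 1) * of_real t powr (z - 1)"
      using a t by (simp add: powr_times_real)
    then have "of_real a powr (- z) * (\<bar>a\<bar> *\<^sub>R f (a * t)) =
        (of_real a powr (- z) * of_real a * complex_of_real a powr (z - 1)) * of_real t powr (z - 1) / of_real (exp (a * t))"
      using a by (simp add: f_def scaleR_conv_of_real)
    then show "of_real a powr (- z) * (\<bar>a\<bar> *\<^sub>R f (a * t)) = of_real t powr (z - 1) * of_real (exp (- (a * t)))"
      unfolding a1 by (simp add: exp_minus divide_inverse)
  qed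
qed

text \<open>Majorants are real, while the Mellin integrals are evaluated with complex integrands. At
  a real exponent the two integrands agree, and taking real parts transfers integrability.\<close>

lemma integrable_powr_over_complexD:
  fixes r :: real and h :: "real \<Rightarrow> real"
  assumes "(\<lambda>t. complex_of_real t powr (of_real r - 1) / of_real (h t)) integrable_on {0..}"
  shows "(\<lambda>t. t powr (r - 1) / h t) integrable_on {0..}"
proof -
  have "(\<lambda>t. Re (complex_of_real t powr (of_real r - 1) / of_real (h t))) integrable_on {0..}"
    using integrable_linear[OF assms bounded_linear_Re] by (simp only: o_def)
  then show ?thesis
  proof (rule integrable_eq)
    fix t :: real assume "t \<in> {0..}"
    then have "complex_of_real t powr (of_real r - 1) = of_real (t powr (r - 1))"
      using powr_of_real[of t "r - 1"] by simp
    then show "Re (complex_of_real t powr (of_real r - 1) / of_real (h t)) = t powr (r - 1) / h t"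
      by (simp only: of_real_divide[symmetric] Re_complex_of_real)
  qed
qed

lemma integrable_powr_over_quadratic:
  fixes r :: real
  assumes "0 < r" "r < 2" "b > 0"
  shows "(\<lambda>t. t powr (r - 1) / (t\<^sup>2 + b\<^sup>2)) integrable_on {0..}"
  using has_integral_integrable[OF has_integral_powr_over_quadratic[of "of_real r" b]] assms
  by (intro integrable_powr_over_complexD) auto

text \<open>For \<open>t > 0\<close>, \<open>1 / cosh t\<close> is twice the alternating sum of
  \<open>exp (- (2 * k + 1) * t)\<close>, and each exponential contributes
  \<open>Gamma s * (2 * k + 1) powr (- s)\<close>. Dominated convergence acts on the partial sums
  and so covers \<open>Re s \<le> 1\<close>, where the beta series converges only
  conditionally.\<close>

lemma has_integral_powr_over_cosh:
  fixes s :: complex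
  assumes s: "Re s > 0"
  shows "((\<lambda>t. of_real t powr (s - 1) / of_real (cosh t)) has_integral (2 * Gamma s * dirichlet_beta s)) {0..}"
proof -
  define g where "g t = of_real t powr (s - 1) / of_real (cosh t)" for t :: real
  define f where "f n t = of_real t powr (s - 1) * of_real (2 * exp (- t) * (\<Sum>k<n. (- exp (- (2 * t))) ^ k))"
    for n and t :: real
  define S where "S n = (\<Sum>k<n. (-1) ^ k * of_nat (2 * k + 1) powr (- s))" for n
  have int: "(f n has_integral 2 * Gamma s * S n) {0..}" for n
  proof -
    have "((\<lambda>t. \<Sum>k<n. 2 * (-1) ^ k * (of_real t powr (s - 1) * of_real (exp (- (real (2 * k + 1) * t))))) has_integral
       (\<Sum>k<n. 2 * (-1) ^ k * (Gamma s * of_real (real (2 * k + 1)) powr (- s)))) {0..}"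
      using s by (intro has_integral_sum has_integral_mult_right has_integral_Gamma_scaled) auto
    also have "(\<Sum>k<n. 2 * (-1) ^ k * (Gamma s * of_real (real (2 * k + 1)) powr (- s))) = 2 * Gamma s * S n"
      unfolding S_def sum_distrib_left by (intro sum.cong refl) (simp only: of_real_of_nat_eq mult_ac)
    finally show ?thesis
    proof (rule has_integral_eq[rotated])
      fix t :: real
      have "exp (- (real (2 * k + 1) * t)) = exp (- t) * exp (- (2 * t)) ^ k" for k
        by (simp add: exp_of_nat_mult[symmetric] exp_add[symmetric] algebra_simps)
      then have "exp (- t) * (- exp (- (2 * t))) ^ k = (-1) ^ k * exp (- (real (2 * k + 1) * t))" for k
        by (simp add: power_minus[of "exp _"])
      then show "(\<Sum>k<n. 2 * (-1) ^ k * (of_real t powr (s - 1) * of_real (exp (- (real (2 * k + 1) * t))))) = f n t"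
        unfolding f_def sum_distrib_left of_real_sum mult.assoc
        by (simp only: mult.assoc of_real_mult of_real_power of_real_minus of_real_1 of_real_numeral)
           (intro sum.cong refl, simp only: mult_ac)
    qed
  qed
  have lim: "(\<lambda>n. f n t) \<longlonglongrightarrow> g t" if "t \<in> {0..}" for t
  \<comment> \<open>At 0 the geometric series has ratio -1 and diverges, but
    \<open>0 powr (s - 1) = 0\<close> makes every \<open>f n 0\<close> and \<open>g 0\<close>
    vanish.\<close>
  proof (cases "t = 0")
    case False
    with that have t: "t > 0" by simp
    have "(\<lambda>n. f n t) \<longlonglongrightarrow> of_real t powr (s - 1) * of_real (2 * exp (- t) * (1 / (1 + exp (- (2 * t)))))"
      unfolding f_def using t by (intro tendsto_mult tendsto_const tendsto_of_real alternating_geometric_sums) auto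
    also have "2 * exp (- t) * (1 / (1 + exp (- (2 * t)))) = 1 / cosh t"
    proof -
      have "cosh t = (1 + exp (- (2 * t))) / (2 * exp (- t))"
        by (simp add: cosh_def field_simps exp_add[symmetric])
      then show ?thesis by simp
    qed
    finally show ?thesis
      by (simp add: g_def)
  qed (simp add: f_def g_def)
  have bound: "norm (f n t) \<le> 4 * (t powr (Re s - 1) / exp t)" if "t \<in> {0..}" for n t
  proof -
    have "\<bar>\<Sum>k<n. (- exp (- (2 * t))) ^ k\<bar> \<le> 2"
      using that by (intro alternating_geometric_sum_bound) auto
    then have "\<bar>2 * exp (- t) * (\<Sum>k<n. (- exp (- (2 * t))) ^ k)\<bar> \<le> 2 * exp (- t) * 2"
      unfolding abs_mult by (intro mult_mono) auto
    then have "norm (f n t) \<le> t powr (Re s - 1) * (2 * exp (- t) * 2)"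
      unfolding f_def norm_mult[of "_ powr _"] norm_of_real using that
      by (intro mult_mono) (auto simp: norm_powr_real_powr)
    then show ?thesis by (simp add: exp_minus divide_inverse mult_ac)
  qed
  have dom: "(\<lambda>t. 4 * (t powr (Re s - 1) / exp t)) integrable_on {0..}"
    using Gamma_integral_real[OF s] by (intro integrable_on_mult_right) (auto simp: integrable_on_def)
  have "f n integrable_on {0..}" for n
    using int by (auto simp: integrable_on_def)
  note dc = dominated_convergence[OF this dom bound lim]
  have G: "Gamma s \<noteq> 0"
    using s by (auto simp: Gamma_eq_zero_iff elim!: nonpos_Ints_cases)
  \<comment> \<open>Division by the nonzero \<open>2 * Gamma s\<close> yields the convergence of the
    beta series along with its sum, as the evaluation of \<open>suminf\<close> requires.\<close>
  from dc(2) have "(\<lambda>n. 2 * Gamma s * S n / (2 * Gamma s)) \<longlonglongrightarrow> integral {0..} g / (2 * Gamma s)"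
    using G by (intro tendsto_divide tendsto_const) (simp_all add: integral_unique[OF int])
  then have "(\<lambda>k. (-1) ^ k * of_nat (2 * k + 1) powr (- s)) sums (integral {0..} g / (2 * Gamma s))"
    using G unfolding sums_def S_def by simp
  then have "dirichlet_beta s = integral {0..} g / (2 * Gamma s)"
    unfolding dirichlet_beta_def by (simp only: sums_iff)
  then have "integral {0..} g = 2 * Gamma s * dirichlet_beta s"
    using G by simp
  with integrable_integral[OF dc(1)] have "(g has_integral 2 * Gamma s * dirichlet_beta s) {0..}"
    by simp
  then show ?thesis
    by (simp only: g_def[abs_def])
qed

lemma integrable_powr_over_cosh:
  fixes r :: real
  assumes "0 < r"
  shows "(\<lambda>t. t powr (r - 1) / cosh t) integrable_on {0..}"
  using has_integral_integrable[OF has_integral_powr_over_cosh[of "of_real r"]] assms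
  by (intro integrable_powr_over_complexD) auto

section \<open>The integral representation\<close>

text \<open>The factor \<open>y^2\<close> is left outside so that partial fractions in
  \<open>t^2\<close> apply to the integrand directly; \<open>y^2\<close> times this function has a
  limit at infinity.\<close>

definition sech_transform :: "complex \<Rightarrow> real \<Rightarrow> complex" where
  "sech_transform s y = integral {0..} (\<lambda>t. of_real t powr (s - 1) / of_real ((t\<^sup>2 + y\<^sup>2) * cosh t))"

text \<open>Nodes are zeros of the cosine. Away from these zeros \<open>cos_quot\<close> is
  therefore the plain quotient, and the fractions in \<open>y\<close> have nonzero
  denominators.\<close>

lemma node_power2_neq:
  assumes "cos y \<noteq> 0"
  shows "(node n)\<^sup>2 \<noteq> y\<^sup>2"
proof
  assume "(node n)\<^sup>2 = y\<^sup>2"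
  then have "cos y = cos (node n)"
    by (auto simp: power2_eq_iff)
  also have "node n = of_int (2 * int n + 1) * (pi / 2)"
    by (simp add: node_def field_simps)
  then have "cos (node n) = 0"
    unfolding cos_zero_iff_int by (intro exI[of _ "2 * int n + 1"]) simp
  finally show False using assms by simp
qed

text \<open>The sech series is integrated termwise against
  \<open>t powr (s - 1) / (t^2 + y^2)\<close>. Each term has two quadratic factors in
  \<open>t\<close>, which partial fractions separate into integrals of known value. The uniform
  bound \<open>C\<close> on the partial sums gives the majorant.\<close>

lemma sech_transform_lim:
  fixes s :: complex and y :: real
  assumes s: "0 < Re s" "Re s < 2" and y: "y \<noteq> 0" "cos y \<noteq> 0"
  defines "K \<equiv> of_real pi / (2 * sin (of_real pi * s / 2))"
  shows "(\<lambda>t. of_real t powr (s - 1) / of_real ((t\<^sup>2 + y\<^sup>2) * cosh t)) integrable_on {0..}"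
    and "(\<lambda>n. (-1) ^ n * of_real (2 * node n / ((node n)\<^sup>2 - y\<^sup>2)) *
           (K * (of_real \<bar>y\<bar> powr (s - 2) - of_real (node n) powr (s - 2)))) sums sech_transform s y"
proof -
  define g where "g t = of_real t powr (s - 1) / of_real ((t\<^sup>2 + y\<^sup>2) * cosh t)" for t :: real
  define f where "f N t = of_real t powr (s - 1) / of_real (t\<^sup>2 + y\<^sup>2) *
      of_real (\<Sum>n<N. (-1) ^ n * (2 * node n / ((node n)\<^sup>2 + t\<^sup>2)))" for N and t :: real
  define a where "a n = (-1) ^ n * of_real (2 * node n / ((node n)\<^sup>2 - y\<^sup>2)) *
           (K * (of_real \<bar>y\<bar> powr (s - 2) - of_real (node n) powr (s - 2)))" for n
  obtain C where C: "\<And>N t. \<bar>\<Sum>n<N. (-1) ^ n * (2 * node n / ((node n)\<^sup>2 + t\<^sup>2))\<bar> \<le> C"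
    using sech_partial_sums_bounded by blast
  have int: "(f N has_integral (\<Sum>n<N. a n)) {0..}" for N
  proof -
    have "((\<lambda>t. of_real t powr (s - 1) / of_real (t\<^sup>2 + \<bar>y\<bar>\<^sup>2)) has_integral K * of_real \<bar>y\<bar> powr (s - 2)) {0..}"
      unfolding K_def using s y by (intro has_integral_powr_over_quadratic) auto
    moreover have "((\<lambda>t. of_real t powr (s - 1) / of_real (t\<^sup>2 + (node n)\<^sup>2)) has_integral K * of_real (node n) powr (s - 2)) {0..}" for n
      unfolding K_def using s node_pos by (intro has_integral_powr_over_quadratic) auto
    ultimately have "((\<lambda>t. \<Sum>n<N. (-1) ^ n * of_real (2 * node n / ((node n)\<^sup>2 - y\<^sup>2)) *
         (of_real t powr (s - 1) / of_real (t\<^sup>2 + \<bar>y\<bar>\<^sup>2) - of_real t powr (s - 1) / of_real (t\<^sup>2 + (node n)\<^sup>2)))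
         has_integral (\<Sum>n<N. a n)) {0..}"
      unfolding a_def right_diff_distrib[of K]
      by (intro has_integral_sum has_integral_mult_right has_integral_diff) auto
    then show ?thesis
    proof (rule has_integral_eq[rotated])
      fix t :: real
      \<comment> \<open>Separates \<open>t^2 + y^2\<close> from \<open>t^2 + (node n)^2\<close>; the
        division by \<open>(node n)^2 - y^2\<close> is where \<open>cos y \<noteq> 0\<close>
        enters.\<close>
      have "2 * node n / ((node n)\<^sup>2 - y\<^sup>2) * (1 / (t\<^sup>2 + y\<^sup>2) - 1 / (t\<^sup>2 + (node n)\<^sup>2)) =
            1 / (t\<^sup>2 + y\<^sup>2) * (2 * node n / ((node n)\<^sup>2 + t\<^sup>2))" for n
      proof -
        have nz: "(node n)\<^sup>2 - y\<^sup>2 \<noteq> 0" "t\<^sup>2 + y\<^sup>2 \<noteq> 0" "t\<^sup>2 + (node n)\<^sup>2 \<noteq> 0"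
          using node_power2_neq[OF y(2), of n] y(1) node_pos[of n] by (auto simp: sum_power2_eq_zero_iff)
        then have "1 / (t\<^sup>2 + y\<^sup>2) - 1 / (t\<^sup>2 + (node n)\<^sup>2) = ((node n)\<^sup>2 - y\<^sup>2) / ((t\<^sup>2 + y\<^sup>2) * (t\<^sup>2 + (node n)\<^sup>2))"
          by (subst diff_frac_eq) auto
        with nz(1) show ?thesis by (simp add: add.commute)
      qed
      then have e: "(-1) ^ n * (2 * node n / ((node n)\<^sup>2 - y\<^sup>2)) * (1 / (t\<^sup>2 + y\<^sup>2) - 1 / (t\<^sup>2 + (node n)\<^sup>2)) =
            1 / (t\<^sup>2 + y\<^sup>2) * ((-1) ^ n * (2 * node n / ((node n)\<^sup>2 + t\<^sup>2)))" for n
        by (simp only: mult.assoc mult.left_commute)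
      have "(-1) ^ n * of_real (2 * node n / ((node n)\<^sup>2 - y\<^sup>2)) *
         (of_real t powr (s - 1) / of_real (t\<^sup>2 + \<bar>y\<bar>\<^sup>2) - of_real t powr (s - 1) / of_real (t\<^sup>2 + (node n)\<^sup>2)) =
         of_real t powr (s - 1) * of_real ((-1) ^ n * (2 * node n / ((node n)\<^sup>2 - y\<^sup>2)) * (1 / (t\<^sup>2 + y\<^sup>2) - 1 / (t\<^sup>2 + (node n)\<^sup>2)))" for n
        by (simp add: right_diff_distrib mult_ac)
      then have "(\<Sum>n<N. (-1) ^ n * of_real (2 * node n / ((node n)\<^sup>2 - y\<^sup>2)) *
         (of_real t powr (s - 1) / of_real (t\<^sup>2 + \<bar>y\<bar>\<^sup>2) - of_real t powr (s - 1) / of_real (t\<^sup>2 + (node n)\<^sup>2))) =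
         (\<Sum>n<N. of_real t powr (s - 1) * of_real (1 / (t\<^sup>2 + y\<^sup>2) * ((-1) ^ n * (2 * node n / ((node n)\<^sup>2 + t\<^sup>2)))))"
        by (simp only: e)
      also have "\<dots> = of_real t powr (s - 1) * of_real (1 / (t\<^sup>2 + y\<^sup>2) * (\<Sum>n<N. (-1) ^ n * (2 * node n / ((node n)\<^sup>2 + t\<^sup>2))))"
        unfolding sum_distrib_left of_real_sum ..
      also have "\<dots> = f N t"
        unfolding f_def of_real_mult of_real_divide by simp
      finally show "(\<Sum>n<N. (-1) ^ n * of_real (2 * node n / ((node n)\<^sup>2 - y\<^sup>2)) *
         (of_real t powr (s - 1) / of_real (t\<^sup>2 + \<bar>y\<bar>\<^sup>2) - of_real t powr (s - 1) / of_real (t\<^sup>2 + (node n)\<^sup>2))) = f N t" .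
    qed
  qed
  have lim: "(\<lambda>N. f N t) \<longlonglongrightarrow> g t" for t
  proof -
    have "(\<lambda>N. f N t) \<longlonglongrightarrow> of_real t powr (s - 1) / of_real (t\<^sup>2 + y\<^sup>2) * of_real (1 / cosh t)"
      unfolding f_def using sech_partial_fractions[of t]
      by (intro tendsto_mult tendsto_const tendsto_of_real) (simp add: sums_def)
    then show ?thesis by (simp add: g_def)
  qed
  have bound: "norm (f N t) \<le> C * (t powr (Re s - 1) / (t\<^sup>2 + \<bar>y\<bar>\<^sup>2))" if "t \<in> {0..}" for N t
  proof -
    have "norm (f N t) \<le> t powr (Re s - 1) / (t\<^sup>2 + y\<^sup>2) * C"
      unfolding f_def norm_mult norm_divide norm_of_real using that C[of t N]
      by (intro mult_mono) (auto simp: norm_powr_real_powr)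
    then show ?thesis by (simp add: mult.commute)
  qed
  have dom: "(\<lambda>t. C * (t powr (Re s - 1) / (t\<^sup>2 + \<bar>y\<bar>\<^sup>2))) integrable_on {0..}"
    using s y by (intro integrable_on_mult_right integrable_powr_over_quadratic) auto
  have "f N integrable_on {0..}" for N
    using int by (auto simp: integrable_on_def)
  note dc = dominated_convergence[OF this dom bound lim]
  from dc(1) show "(\<lambda>t. of_real t powr (s - 1) / of_real ((t\<^sup>2 + y\<^sup>2) * cosh t)) integrable_on {0..}"
    unfolding g_def .
  from dc(2) show "(\<lambda>n. (-1) ^ n * of_real (2 * node n / ((node n)\<^sup>2 - y\<^sup>2)) *
           (K * (of_real \<bar>y\<bar> powr (s - 2) - of_real (node n) powr (s - 2)))) sums sech_transform s y"
    unfolding sums_def sech_transform_def a_def[symmetric] integral_unique[OF int] g_def .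
qed

text \<open>Multiply the secant series at \<open>y\<close> by
  \<open>K * \<bar>y\<bar> powr (s - 2)\<close> and subtract the series of the transform: the powers
  of \<open>\<bar>y\<bar>\<close> cancel termwise, and the series in \<open>g_half\<close> remains
  up to a factor, its convergence included. As \<open>2 * K = pi / sin (pi * s / 2)\<close>, the
  secant part of \<open>g_half\<close> is exactly \<open>f_half\<close>.\<close>

lemma f_half_minus_g_half:
  fixes s :: complex and y :: real
  assumes s: "0 < Re s" "Re s < 2" and y: "y \<noteq> 0" "cos y \<noteq> 0"
  shows "f_half s y - g_half s y = 2 powr (s - 1) * of_real (cos y) * (of_real (y\<^sup>2) * sech_transform s y)"
proof -
  define K where "K = of_real pi / (2 * sin (of_real pi * s / 2))"
  define J where "J = sech_transform s y"
  define Y where "Y = complex_of_real \<bar>y\<bar> powr (s - 2)"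
  have "sin (of_real pi * (s / 2)) \<noteq> 0"
    by (rule sin_pi_times_nonzero[OF half_notin_Ints[OF s]])
  then have K: "K \<noteq> 0"
    by (simp add: K_def)
  have "(\<lambda>n. (-1) ^ n * of_real (2 * node n / ((node n)\<^sup>2 - y\<^sup>2))) sums (1 / complex_of_real (cos y))"
    using sec_partial_fractions[of "of_real y"] y by (simp add: cos_of_real)
  note sec = this
  have cancel: "K * Y * x - x * (K * (Y - a)) = K * (x * a)" for x a
    by (simp add: algebra_simps)
  from sums_diff[OF sums_mult[OF sec, of "K * Y"] sech_transform_lim(2)[OF s y, folded K_def J_def Y_def]]
  have "(\<lambda>n. K * ((-1) ^ n * of_real (2 * node n / ((node n)\<^sup>2 - y\<^sup>2)) * of_real (node n) powr (s - 2))) sums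
       (K * Y * (1 / of_real (cos y)) - J)"
    by (simp only: cancel)
  \<comment> \<open>The factor removes \<open>K\<close> and the 2 of the secant terms, supplies the
    cosine in \<open>cos_quot\<close>, and turns \<open>(node n)^2 - y^2\<close> into
    \<open>y^2 - (node n)^2\<close>. The numerator \<open>node n\<close> raises the exponent from
    \<open>s - 2\<close> to \<open>s - 1\<close>.\<close>
  from sums_mult[OF this, of "- of_real (cos y) / (2 * K)"]
  have "(\<lambda>n. (- of_real (cos y) / (2 * K)) * (K * ((-1) ^ n * of_real (2 * node n / ((node n)\<^sup>2 - y\<^sup>2)) * of_real (node n) powr (s - 2)))) sums
       ((- of_real (cos y) / (2 * K)) * (K * Y * (1 / of_real (cos y)) - J))" .
  also have "(\<lambda>n. (- of_real (cos y) / (2 * K)) * (K * ((-1) ^ n * of_real (2 * node n / ((node n)\<^sup>2 - y\<^sup>2)) * of_real (node n) powr (s - 2)))) =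
    (\<lambda>n. (-1) ^ n * of_real (node n) powr (s - 1) * of_real (cos_quot n y))"
  proof
    fix n
    have p: "of_real (node n) powr (s - 1) = of_real (node n) powr (s - 2) * complex_of_real (node n)"
      using complex_of_real_powr_add_nat[OF node_pos, of n "s - 2" 1] by simp
    have "cos_quot n y = cos y / (y\<^sup>2 - (node n)\<^sup>2)"
      using node_power2_neq[OF y(2), of n] by (simp add: cos_quot_def)
    also have "\<dots> = - cos y / ((node n)\<^sup>2 - y\<^sup>2)"
      using minus_divide_right[of "cos y" "(node n)\<^sup>2 - y\<^sup>2"] by simp
    finally have q: "cos_quot n y = - cos y / ((node n)\<^sup>2 - y\<^sup>2)" .
    show "(- of_real (cos y) / (2 * K)) * (K * ((-1) ^ n * of_real (2 * node n / ((node n)\<^sup>2 - y\<^sup>2)) * of_real (node n) powr (s - 2))) =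
      (-1) ^ n * of_real (node n) powr (s - 1) * of_real (cos_quot n y)"
      unfolding p q using K by simp
  qed
  finally have "(\<Sum>n. (-1) ^ n * of_real (node n) powr (s - 1) * of_real (cos_quot n y)) =
      (- of_real (cos y) / (2 * K)) * (K * Y * (1 / of_real (cos y)) - J)"
    by (simp only: sums_iff)
  also have "\<dots> = - Y / 2 + of_real (cos y) * J / (2 * K)"
    using y K by (simp add: field_simps)
  finally have series: "(\<Sum>n. (-1) ^ n * of_real (node n) powr (s - 1) * of_real (cos_quot n y)) =
      - Y / 2 + of_real (cos y) * J / (2 * K)" .
  have two: "(2::complex) powr (s - 1) = 2 powr (s - 2) * 2"
    using complex_of_real_powr_add_nat[of 2 "s - 2" 1] by simp
  have Ys: "complex_of_real \<bar>y\<bar> powr s = Y * of_real (y\<^sup>2)"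
    using complex_of_real_powr_add_nat[of "\<bar>y\<bar>" "s - 2" 2] y by (simp add: Y_def)
  have piK: "of_real pi / sin (of_real pi * s / 2) = 2 * K"
    by (simp add: K_def)
  have f: "f_half s y = 2 * K * 2 powr (s - 2) * (Y * of_real (y\<^sup>2))"
    unfolding f_half_def Ys piK[symmetric] by simp
  have "g_half s y = - (2 * K * 2 powr (s - 1) * of_real (y\<^sup>2)) * (- Y / 2 + of_real (cos y) * J / (2 * K))"
    unfolding g_half_def series piK[symmetric] by simp
  also have "\<dots> = K * 2 powr (s - 1) * of_real (y\<^sup>2) * Y - 2 powr (s - 1) * of_real (y\<^sup>2) * of_real (cos y) * J"
    using K by (simp add: field_simps)
  finally show ?thesis
    unfolding f two J_def by (simp add: algebra_simps)
qed

text \<open>The kernel \<open>y^2 / (t^2 + y^2)\<close> lies between 0 and 1 and differs from 1 by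
  at most \<open>t^2 / y^2\<close>. Hence the Mellin integral of sech at \<open>Re s\<close> bounds
  the whole and the one at \<open>Re s + 2\<close> the error. The error bound serves for large
  \<open>y\<close>, the other one near 0.\<close>

lemma sech_transform_asymptotics:
  fixes s :: complex
  assumes s: "0 < Re s" "Re s < 2"
  obtains D where "\<And>y. y \<noteq> 0 \<Longrightarrow> cos y \<noteq> 0 \<Longrightarrow>
        norm (of_real (y\<^sup>2) * sech_transform s y - 2 * Gamma s * dirichlet_beta s) \<le> D / y\<^sup>2"
    and "\<And>y. y \<noteq> 0 \<Longrightarrow> cos y \<noteq> 0 \<Longrightarrow> norm (of_real (y\<^sup>2) * sech_transform s y) \<le> D"
proof -
  define D0 D2 where "D0 = integral {0..} (\<lambda>t. t powr (Re s - 1) / cosh t)"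
    and "D2 = integral {0..} (\<lambda>t. t powr (Re s + 2 - 1) / cosh t)"
  have int0: "(\<lambda>t. t powr (Re s - 1) / cosh t) integrable_on {0..}"
    and int2: "(\<lambda>t. t powr (Re s + 2 - 1) / cosh t) integrable_on {0..}"
    using integrable_powr_over_cosh[of "Re s"] integrable_powr_over_cosh[of "Re s + 2"] s by auto
  have *: "norm (of_real (y\<^sup>2) * sech_transform s y - 2 * Gamma s * dirichlet_beta s) \<le> D2 / y\<^sup>2 \<and>
     norm (of_real (y\<^sup>2) * sech_transform s y) \<le> D0" if y: "y \<noteq> 0" "cos y \<noteq> 0" for y
  proof
    define k where "k t = of_real t powr (s - 1) / of_real (cosh t)" for t :: real
    define h where "h t = of_real (y\<^sup>2) * (of_real t powr (s - 1) / of_real ((t\<^sup>2 + y\<^sup>2) * cosh t))" for t :: real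
    have h_alt: "h t = k t * of_real (y\<^sup>2 / (t\<^sup>2 + y\<^sup>2))" for t
      by (simp add: h_def k_def mult_ac)
    have h: "(h has_integral (of_real (y\<^sup>2) * sech_transform s y)) {0..}"
      unfolding h_def sech_transform_def
      by (intro has_integral_mult_right integrable_integral sech_transform_lim s y)
    have k: "(k has_integral (2 * Gamma s * dirichlet_beta s)) {0..}"
      unfolding k_def by (rule has_integral_powr_over_cosh[OF s(1)])
    have nk: "norm (k t) = t powr (Re s - 1) / cosh t" if "t \<in> {0..}" for t
      using that by (simp add: k_def norm_divide norm_powr_real_powr)
    have "norm (integral {0..} h) \<le> D0"
      unfolding D0_def
    proof (rule integral_norm_bound_integral[OF _ int0])
      fix t :: real assume t: "t \<in> {0..}"
      have "norm (h t) = t powr (Re s - 1) / cosh t * (y\<^sup>2 / (t\<^sup>2 + y\<^sup>2))"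
        unfolding h_alt norm_mult nk[OF t] norm_of_real by simp
      also have "\<dots> \<le> t powr (Re s - 1) / cosh t * 1"
        using y(1) by (intro mult_left_mono) (auto simp: divide_le_eq_1 add_nonneg_pos)
      finally show "norm (h t) \<le> t powr (Re s - 1) / cosh t" by simp
    qed (use h in \<open>auto simp: integrable_on_def\<close>)
    then show "norm (of_real (y\<^sup>2) * sech_transform s y) \<le> D0"
      using integral_unique[OF h] by simp
    have "norm (integral {0..} (\<lambda>t. h t - k t)) \<le> integral {0..} (\<lambda>t. 1 / y\<^sup>2 * (t powr (Re s + 2 - 1) / cosh t))"
    proof (rule integral_norm_bound_integral)
      fix t :: real assume t: "t \<in> {0..}"
      have "y\<^sup>2 / (t\<^sup>2 + y\<^sup>2) - 1 = - (t\<^sup>2 / (t\<^sup>2 + y\<^sup>2))"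
        using y(1) by (simp add: field_simps sum_power2_eq_zero_iff)
      moreover have "h t - k t = k t * of_real (y\<^sup>2 / (t\<^sup>2 + y\<^sup>2) - 1)"
        unfolding h_alt by (simp add: algebra_simps)
      ultimately have "norm (h t - k t) = t powr (Re s - 1) / cosh t * (t\<^sup>2 / (t\<^sup>2 + y\<^sup>2))"
        unfolding norm_mult by (simp only: norm_mult nk[OF t] norm_of_real) simp
      also have "\<dots> \<le> t powr (Re s - 1) / cosh t * (t\<^sup>2 / y\<^sup>2)"
        using y(1) by (intro mult_left_mono divide_left_mono) (auto simp: add_nonneg_pos)
      also have "\<dots> = 1 / y\<^sup>2 * (t powr (Re s - 1) * t\<^sup>2 / cosh t)"
        by simp
      also have "t powr (Re s - 1) * t\<^sup>2 = t powr (Re s + 2 - 1)"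
      proof (cases "t = 0")
        case False
        then have "t\<^sup>2 = t powr 2" using t by (simp add: powr_numeral)
        then show ?thesis by (simp add: powr_add[symmetric] algebra_simps)
      qed simp
      finally show "norm (h t - k t) \<le> 1 / y\<^sup>2 * (t powr (Re s + 2 - 1) / cosh t)" .
    next
      show "(\<lambda>t. h t - k t) integrable_on {0..}"
        using has_integral_diff[OF h k] by (auto simp: integrable_on_def)
      show "(\<lambda>t. 1 / y\<^sup>2 * (t powr (Re s + 2 - 1) / cosh t)) integrable_on {0..}"
        by (intro integrable_on_mult_right int2)
    qed
    also have "\<dots> = D2 / y\<^sup>2"
      unfolding D2_def using integral_mult_right[of "{0..}" "1 / y\<^sup>2" "\<lambda>t. t powr (Re s + 2 - 1) / cosh t"] by simp
    finally show "norm (of_real (y\<^sup>2) * sech_transform s y - 2 * Gamma s * dirichlet_beta s) \<le> D2 / y\<^sup>2"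
      using integral_unique[OF has_integral_diff[OF h k]] by simp
  qed
  show ?thesis
  proof (rule that[of "max D0 D2"])
    fix y :: real assume y: "y \<noteq> 0" "cos y \<noteq> 0"
    have "D2 / y\<^sup>2 \<le> max D0 D2 / y\<^sup>2"
      by (intro divide_right_mono) auto
    then show "norm (of_real (y\<^sup>2) * sech_transform s y - 2 * Gamma s * dirichlet_beta s) \<le> max D0 D2 / y\<^sup>2"
      using *[OF y] by linarith
    show "norm (of_real (y\<^sup>2) * sech_transform s y) \<le> max D0 D2"
      using *[OF y] by linarith
  qed
qed

section \<open>Integrability\<close>

lemma AE_cos_nonzero: "AE y in lborel. y \<noteq> 0 \<and> cos y \<noteq> (0::real)"
proof (rule AE_I')
  show "range (\<lambda>i::int. of_int i * (pi / 2)) \<in> null_sets lborel"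
    by (intro countable_imp_null_set_lborel countable_image) auto
  have "y \<in> range (\<lambda>i::int. of_int i * (pi / 2))" if "y = 0 \<or> cos y = 0" for y :: real
    using that unfolding cos_zero_iff_int by (auto intro: image_eqI[of _ _ 0])
  then show "{y \<in> space lborel. \<not> (y \<noteq> 0 \<and> cos y \<noteq> 0)} \<subseteq> range (\<lambda>i::int. of_int i * (pi / 2))"
    by auto
qed

text \<open>The \<open>Lim\<close> clause affects only the points \<open>node n\<close> and
  \<open>- node n\<close>: the function is a measurable quotient, altered by constants at two
  points.\<close>

lemma borel_measurable_cos_quot [measurable]: "cos_quot n \<in> borel_measurable borel"
proof -
  define c where "c y = Lim (at y) (\<lambda>x. cos x / (x\<^sup>2 - (node n)\<^sup>2))" for y
  have "cos_quot n = (\<lambda>y. if y = node n then c (node n) else if y = - node n then c (- node n)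
          else cos y / (y\<^sup>2 - (node n)\<^sup>2))"
    by (auto simp: fun_eq_iff cos_quot_def c_def power2_eq_iff)
  also have "\<dots> \<in> borel_measurable borel"
    by measurable
  finally show ?thesis .
qed

lemma borel_measurable_f_half: "f_half s \<in> borel_measurable borel"
proof -
  have "(\<lambda>y. complex_of_real \<bar>y\<bar> powr s) = (\<lambda>y. if y = 0 then 0 else exp (s * of_real (ln \<bar>y\<bar>)))"
    by (auto simp: fun_eq_iff powr_def Ln_of_real)
  also have "\<dots> \<in> borel_measurable borel"
    by measurable
  finally have [measurable]: "(\<lambda>y. complex_of_real \<bar>y\<bar> powr s) \<in> borel_measurable borel" .
  show ?thesis
    unfolding f_half_def[abs_def] by measurable
qed

lemma borel_measurable_g_half: "g_half s \<in> borel_measurable borel"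
  unfolding g_half_def[abs_def] by measurable

lemma borel_measurable_lebesgue_f_half_minus_g_half:
  "(\<lambda>y. f_half s y - g_half s y) \<in> borel_measurable lebesgue"
  using borel_measurable_diff[OF borel_measurable_f_half borel_measurable_g_half, of s s]
  by (intro measurable_completion) simp

text \<open>Outside \<open>[-1, 1]\<close> the integrand is dominated by a multiple of
  \<open>\<bar>y\<bar> powr (- 2 * p)\<close>, integrable because \<open>2 * p > 1\<close>. This is
  the source of the threshold \<open>1 / 2\<close> for \<open>p\<close>.\<close>

lemma nn_integral_powr_decay_finite:
  fixes p B :: real
  assumes p: "p > 1 / 2" and B: "B \<ge> 0"
  shows "(\<integral>\<^sup>+y. ennreal ((2 * B / (1 + y\<^sup>2)) powr p) \<partial>lborel) < \<infinity>"
proof -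
  define h where "h y = indicator {1..} y * ennreal ((2 * B) powr p * y powr (- 2 * p))" for y :: real
  have [measurable]: "h \<in> borel_measurable borel"
    unfolding h_def[abs_def] by measurable
  have "((\<lambda>y::real. (2 * B) powr p * y powr (- 2 * p)) has_integral
      (2 * B) powr p * (- (1 powr (- 2 * p + 1)) / (- 2 * p + 1))) {1..}"
    using p by (intro has_integral_mult_right has_integral_powr_to_inf) auto
  then have "(\<integral>\<^sup>+y. ennreal (indicator {1..} y * ((2 * B) powr p * y powr (- 2 * p))) \<partial>lborel) < \<infinity>"
    by (subst nn_integral_has_integral_lebesgue) auto
  then have h1: "(\<integral>\<^sup>+y. h y \<partial>lborel) < \<infinity>"
    by (simp add: h_def ennreal_mult'' ennreal_indicator)
  have h2: "(\<integral>\<^sup>+y. h (- y) \<partial>lborel) < \<infinity>"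
    using h1 nn_integral_real_affine[of h "-1" 0] by simp
  \<comment> \<open>On \<open>[-1, 1]\<close> the constant \<open>(2 * B) powr p\<close> suffices;
    beyond it, \<open>1 / (1 + y^2) \<le> 1 / y^2\<close>. \<open>h\<close> lives on the right
    half-line, and its reflection covers the left one.\<close>
  have le: "ennreal ((2 * B / (1 + y\<^sup>2)) powr p) \<le>
      ennreal ((2 * B) powr p) * indicator {-1..1} y + (h y + h (- y))" for y
  proof (cases "\<bar>y\<bar> \<le> 1")
    case True
    have "2 * B / (1 + y\<^sup>2) \<le> 2 * B"
      using mult_left_mono[of 1 "1 + y\<^sup>2" "2 * B"] B by (simp add: pos_divide_le_eq add_pos_nonneg)
    then have "(2 * B / (1 + y\<^sup>2)) powr p \<le> (2 * B) powr p"
      using p B by (intro powr_mono2) auto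
    with True show ?thesis
      by (auto simp: indicator_def abs_le_iff intro!: add_increasing2 ennreal_leI)
  next
    case False
    have "2 * B / (1 + y\<^sup>2) \<le> 2 * B * \<bar>y\<bar> powr (- 2)"
      using False B by (auto simp: powr_minus powr_numeral divide_inverse intro!: mult_left_mono le_imp_inverse_le)
    then have "(2 * B / (1 + y\<^sup>2)) powr p \<le> (2 * B * \<bar>y\<bar> powr (- 2)) powr p"
      using p B by (intro powr_mono2) auto
    also have "\<dots> = (2 * B) powr p * \<bar>y\<bar> powr (- 2 * p)"
      using B by (simp add: powr_mult powr_powr)
    finally have "ennreal ((2 * B / (1 + y\<^sup>2)) powr p) \<le> ennreal ((2 * B) powr p * \<bar>y\<bar> powr (- 2 * p))"
      by (rule ennreal_leI)
    also have "\<dots> \<le> h y + h (- y)"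
      using False by (cases "y \<ge> 0") (auto simp: h_def indicator_def)
    finally show ?thesis
      by (simp add: add_increasing)
  qed
  have "(\<integral>\<^sup>+y. ennreal ((2 * B / (1 + y\<^sup>2)) powr p) \<partial>lborel) \<le>
     (\<integral>\<^sup>+y. ennreal ((2 * B) powr p) * indicator {-1..1} y + (h y + h (- y)) \<partial>lborel)"
    by (intro nn_integral_mono le)
  also have "\<dots> = ennreal ((2 * B) powr p) * emeasure lborel {-1..1::real} + ((\<integral>\<^sup>+y. h y \<partial>lborel) + (\<integral>\<^sup>+y. h (- y) \<partial>lborel))"
    by (simp add: nn_integral_add nn_integral_cmult_indicator)
  also have "\<dots> < \<infinity>"
    using h1 h2 by (simp add: ennreal_mult_less_top)
  finally show ?thesis .
qed

text \<open>On every interval \<open>[2 * k * pi, 2 * k * pi + 1]\<close> the cosine is at least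
  \<open>1 / 2\<close>, since \<open>1 < pi / 3\<close>. These intervals are disjoint and of measure
  1, and infinitely many lie beyond \<open>R\<close>.\<close>

lemma emeasure_cos_ge_half_infinite:
  fixes R :: real
  shows "emeasure lborel {y. y \<ge> R \<and> cos y \<ge> 1 / 2} = \<infinity>"
proof -
  define S where "S = {y::real. y \<ge> R \<and> cos y \<ge> 1 / 2}"
  \<comment> \<open>Shifting the index by \<open>m\<close> places all intervals beyond
    \<open>R\<close>, as \<open>2 * (m + k) * pi \<ge> m \<ge> R\<close>.\<close>
  obtain m :: nat where m: "R \<le> real m" using real_arch_simple by blast
  define A where "A k = {2 * real (m + k) * pi .. 2 * real (m + k) * pi + 1}" for k
  have A_sub: "A k \<subseteq> S" for k
  proof
    fix y assume y: "y \<in> A k"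
    define u where "u = y - 2 * real (m + k) * pi"
    have u: "0 \<le> u" "u \<le> 1" and y_eq: "y = 2 * real (m + k) * pi + u"
      using y by (auto simp: A_def u_def)
    have "cos y = cos u"
      unfolding y_eq cos_add cos_2npi sin_2npi by simp
    moreover have "cos (pi / 3) \<le> cos u"
      using u pi_gt3 by (intro cos_monotone_0_pi_le) auto
    moreover have "real m \<le> 2 * real (m + k) * pi"
    proof -
      have "real m \<le> real (m + k) * 1" by simp
      also have "\<dots> \<le> real (m + k) * (2 * pi)"
        using pi_gt3 by (intro mult_left_mono) auto
      finally show ?thesis by (simp add: mult_ac)
    qed
    ultimately show "y \<in> S"
      using u y_eq m by (simp add: S_def cos_60)
  qed
  have disj: "disjoint_family A"
    unfolding disjoint_family_on_def
  proof (intro ballI impI)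
    have *: "A i \<inter> A j = {}" if "i < j" for i j
    proof -
      have "2 * real (m + i) * pi + 1 < 2 * real (m + j) * pi"
      proof -
        have "(real (m + i) + 1) * (2 * pi) \<le> real (m + j) * (2 * pi)"
          using that by (intro mult_right_mono) auto
        then show ?thesis using pi_gt3 by (simp add: algebra_simps)
      qed
      then show ?thesis by (auto simp: A_def)
    qed
    fix i j :: nat assume "i \<noteq> j"
    then show "A i \<inter> A j = {}"
      using *[of i j] *[of j i] by (cases "i < j") auto
  qed
  have S: "S \<in> sets lborel"
    unfolding S_def by measurable
  have ge: "of_nat n \<le> emeasure lborel S" for n
  proof -
    have "(of_nat n :: ennreal) = (\<Sum>k<n. emeasure lborel (A k))"
      by (simp add: A_def)
    also have "\<dots> = emeasure lborel (\<Union>k<n. A k)"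
      by (intro sum_emeasure disjoint_family_on_mono[OF _ disj]) (auto simp: A_def)
    also have "\<dots> \<le> emeasure lborel S"
      using A_sub by (intro emeasure_mono S) auto
    finally show ?thesis .
  qed
  have "emeasure lborel S = \<infinity>"
  proof (rule ccontr)
    assume "emeasure lborel S \<noteq> \<infinity>"
    then obtain r where r: "emeasure lborel S = ennreal r" "r \<ge> 0"
      by (cases "emeasure lborel S") auto
    obtain n where "r < real n" using reals_Archimedean2 by blast
    then have "ennreal r < of_nat n"
      using r by (simp add: ennreal_of_nat_eq_real_of_nat ennreal_less_iff)
    with ge[of n] show False unfolding r(1) by (meson leD)
  qed
  then show ?thesis by (simp add: S_def)
qed

section \<open>Finiteness of the p-th power integral of f - g and the vanishing of beta\<close>

theorem corollary2p6:
  fixes s :: complex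
  assumes "0 < Re s" and "Re s < 1"
  shows "(dirichlet_beta s = 0 \<longrightarrow>
            (\<forall>p>1/2. (\<lambda>y. f_half s y - g_half s y) \<in> Lp_space p)) \<and>
         ((\<exists>p>1/2. (\<lambda>y. f_half s y - g_half s y) \<in> Lp_space p) \<longrightarrow>
            dirichlet_beta s = 0)"
proof -
  define F where "F y = f_half s y - g_half s y" for y
  define q where "q = norm ((2::complex) powr (s - 1))"
  have q: "q > 0" by (simp add: q_def)
  have s: "0 < Re s" "Re s < 2" using assms by auto
  obtain D where D: "\<And>y. y \<noteq> 0 \<Longrightarrow> cos y \<noteq> 0 \<Longrightarrow>
        norm (of_real (y\<^sup>2) * sech_transform s y - 2 * Gamma s * dirichlet_beta s) \<le> D / y\<^sup>2"
    "\<And>y. y \<noteq> 0 \<Longrightarrow> cos y \<noteq> 0 \<Longrightarrow> norm (of_real (y\<^sup>2) * sech_transform s y) \<le> D"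
    using sech_transform_asymptotics[OF s] by blast
  have F: "norm (F y) = q * \<bar>cos y\<bar> * norm (of_real (y\<^sup>2) * sech_transform s y)"
    if "y \<noteq> 0" "cos y \<noteq> 0" for y
    unfolding F_def f_half_minus_g_half[OF s that] q_def by (simp add: norm_mult)
  have [measurable]: "F \<in> borel_measurable borel"
    using borel_measurable_diff[OF borel_measurable_f_half borel_measurable_g_half, of s s]
    unfolding F_def[abs_def] .
  have Lp_iff: "F \<in> Lp_space p \<longleftrightarrow> (\<integral>\<^sup>+ y. ennreal (norm (F y) powr p) \<partial>lborel) < \<infinity>" for p
    unfolding Lp_space_def using borel_measurable_lebesgue_f_half_minus_g_half[of s]
    by (simp add: F_def[abs_def, symmetric] nn_integral_completion)
  have "F \<in> Lp_space p" if beta: "dirichlet_beta s = 0" and p: "p > 1 / 2" for p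
  proof -
    \<comment> \<open>At \<open>y = pi\<close> neither \<open>y\<close> nor \<open>cos y\<close>
      vanishes, and there \<open>D\<close> bounds a norm.\<close>
    have "D \<ge> 0" using order.trans[OF norm_ge_zero D(2)[of pi]] by simp
    have "AE y in lborel. ennreal (norm (F y) powr p) \<le> ennreal ((2 * (q * D) / (1 + y\<^sup>2)) powr p)"
      using AE_cos_nonzero
    proof eventually_elim
      case (elim y)
      define n where "n = norm (of_real (y\<^sup>2) * sech_transform s y)"
      have y2: "y\<^sup>2 > 0" using elim by simp
      \<comment> \<open>With \<open>dirichlet_beta s = 0\<close> the error bound reads
        \<open>n * y^2 \<le> D\<close>. Adding \<open>n \<le> D\<close> merges the bound near 0 and
        the decay into one majorant \<open>2 * D / (1 + y^2)\<close>.\<close>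
      have n: "n \<le> D" "n * y\<^sup>2 \<le> D"
        using D(1)[of y] D(2)[of y] elim beta y2 by (simp_all add: n_def pos_le_divide_eq)
      then have "n * (1 + y\<^sup>2) \<le> 2 * D" by (simp add: algebra_simps)
      then have "n \<le> 2 * D / (1 + y\<^sup>2)"
        using y2 by (simp add: pos_le_divide_eq add_pos_pos)
      then have "q * n \<le> q * (2 * D / (1 + y\<^sup>2))"
        using q by (intro mult_left_mono) auto
      moreover have "norm (F y) \<le> q * n"
        using F[of y] elim q abs_cos_le_one[of y] mult_left_le[of "\<bar>cos y\<bar>" "q * n"]
        by (simp add: n_def mult_ac)
      ultimately have "norm (F y) \<le> 2 * (q * D) / (1 + y\<^sup>2)"
        by (simp add: mult_ac)
      then show ?case
        using p by (intro ennreal_leI powr_mono2) auto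
    qed
    then have "(\<integral>\<^sup>+ y. ennreal (norm (F y) powr p) \<partial>lborel) \<le>
        (\<integral>\<^sup>+ y. ennreal ((2 * (q * D) / (1 + y\<^sup>2)) powr p) \<partial>lborel)"
      by (rule nn_integral_mono_AE)
    also have "\<dots> < \<infinity>"
      using p q \<open>D \<ge> 0\<close> by (intro nn_integral_powr_decay_finite) auto
    finally show ?thesis unfolding Lp_iff .
  qed
  moreover have "dirichlet_beta s = 0" if p: "p > 1 / 2" and Lp: "F \<in> Lp_space p" for p
  proof (rule ccontr)
    assume beta: "dirichlet_beta s \<noteq> 0"
    have "Gamma s \<noteq> 0"
      using s by (auto simp: Gamma_eq_zero_iff elim!: nonpos_Ints_cases)
    define c where "c = norm (2 * Gamma s * dirichlet_beta s)"
    have c: "c > 0" by (simp add: c_def \<open>Gamma s \<noteq> 0\<close> beta)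
    \<comment> \<open>For \<open>y \<ge> R\<close> also \<open>y^2 \<ge> y \<ge> 2 * D / c\<close>,
      so the error \<open>D / y^2\<close> is at most half of the limiting modulus \<open>c\<close>.
      The 1 in the maximum is there for \<open>y^2 \<ge> y\<close>.\<close>
    define R where "R = max 1 (2 * D / c)"
    define S where "S = {y. y \<ge> R \<and> cos y \<ge> 1 / 2}"
    have S: "S \<in> sets lborel"
      unfolding S_def by measurable
    \<comment> \<open>On \<open>S\<close> the cosine is at least \<open>1 / 2\<close> and
      \<open>y^2\<close> times the transform has norm at least \<open>c / 2\<close>, almost
      everywhere; hence \<open>q * (c / 4)\<close> as lower bound for
      \<open>norm (F y)\<close>.\<close>
    define e where "e = (q * (c / 4)) powr p"
    have e: "e > 0" using q c by (simp add: e_def)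
    have "AE y in lborel. ennreal e * indicator S y \<le> ennreal (norm (F y) powr p)"
      using AE_cos_nonzero
    proof eventually_elim
      case (elim y)
      show ?case
      proof (cases "y \<in> S")
        case True
        then have y: "y \<ge> 1" "y \<ge> 2 * D / c" "cos y \<ge> 1 / 2" by (auto simp: S_def R_def)
        define n where "n = norm (of_real (y\<^sup>2) * sech_transform s y)"
        have "2 * D / c \<le> y\<^sup>2"
          using y(2) self_le_power[OF y(1), of 2] by simp
        then have "D / y\<^sup>2 \<le> c / 2"
          using c y by (simp add: field_simps)
        moreover have "c - n \<le> D / y\<^sup>2"
          using D(1)[of y] elim norm_triangle_ineq2[of "2 * Gamma s * dirichlet_beta s" "of_real (y\<^sup>2) * sech_transform s y"]
          by (simp add: c_def n_def norm_minus_commute)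
        ultimately have "c / 2 \<le> n" by linarith
        then have "q * (1 / 2) * (c / 2) \<le> q * \<bar>cos y\<bar> * n"
          using q c y by (intro mult_mono) auto
        then have "q * (c / 4) \<le> norm (F y)"
          using F[of y] elim by (simp add: n_def)
        then have "e \<le> norm (F y) powr p"
          unfolding e_def using p q c by (intro powr_mono2) auto
        then show ?thesis using True by (simp add: ennreal_leI)
      qed simp
    qed
    then have "(\<integral>\<^sup>+ y. ennreal e * indicator S y \<partial>lborel) \<le> (\<integral>\<^sup>+ y. ennreal (norm (F y) powr p) \<partial>lborel)"
      by (rule nn_integral_mono_AE)
    also have "\<dots> < \<infinity>" using Lp unfolding Lp_iff .
    also have "(\<integral>\<^sup>+ y. ennreal e * indicator S y \<partial>lborel) = ennreal e * emeasure lborel S"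
      using S by (rule nn_integral_cmult_indicator)
    also have "emeasure lborel S = \<infinity>"
      unfolding S_def by (rule emeasure_cos_ge_half_infinite)
    finally show False using e by (simp add: ennreal_mult_top)
  qed
  ultimately show ?thesis
    unfolding F_def[abs_def] by blast
qed

end
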